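(* Let $d\ge2$ be an integer and $\alpha\in(0,1)$. Let $h_\alpha:\mathbb R\to\mathbb R$ be given by $h_\alpha(t)=\sum_{k=0}^\infty 2^{-k\alpha}\cos(2\pi 2^k t)$, and define, for $x=(x_1,\dots,x_d)$ and $y=(y_1,\dots,y_d)$ in $[0,1]^d$, $$W(x,y)=\frac12+a\sum_{i=1}^d h_\alpha(x_i-y_i),$$ where $a>0$ is chosen so small that $0\le W(x,y)\le1$ for all $x,y\in[0,1]^d$. Then $W$ is a graphon on $[0,1]^d$ (with Lebesgue measure) that is Hölder$(\alpha)$, and $W$ is not equivalent to any graphon on $[0,1]$ (with Lebesgue measure) that is Hölder$(\beta)$ for any $\beta\in(0,1]$ with $\beta>\alpha/d$.
   Context: A graphon on a probability space $(\mathcal S,\mathcal F,\mu)$ is a symmetric measurable function $W:\mathcal S^2\to[0,1]$. The spaces $[0,1]$ and $[0,1]^d$ are regarded as probability spaces with Lebesgue measure. Equivalence: two graphons $W_1$ on $(\mathcal S_1,\mu_1)$ and $W_2$ on $(\mathcal S_2,\mu_2)$ (possibly different probability spaces) are equivalent (weakly isomorphic) if $t(F,W_1)=t(F,W_2)$ for every finite simple graph $F$, where $t(F,W)=\int_{\mathcal S^{V(F)}}\prod_{ij\in E(F)}W(x_i,x_j)\prod_{i\in V(F)}d\mu(x_i)$. Hölder continuity: for $\alpha\in(0,1]$, a real function $f$ on a subset $D$ of a Euclidean space is Hölder$(\alpha)$ if there is a constant $C<\infty$ with $|f(x)-f(y)|\le C|x-y|^\alpha$ for all $x,y\in D$. A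 graphon on $[0,1]^d$ is regarded as a function on $[0,1]^{2d}\subset\mathbb R^{2d}$ for this purpose. *)

theory Defs
  imports "HOL-Analysis.Analysis" "HOL-Probability.Probability_Measure"
begin

section \<open>Graphons and their equivalence\<close>

definition graphon :: "'a measure \<Rightarrow> ('a \<Rightarrow> 'a \<Rightarrow> real) \<Rightarrow> bool" where
  "graphon M W \<longleftrightarrow>
     prob_space M \<and>
     (\<lambda>(x, y). W x y) \<in> borel_measurable (M \<Otimes>\<^sub>M M) \<and>
     (\<forall>x\<in>space M. \<forall>y\<in>space M. W x y = W y x \<and> 0 \<le> W x y \<and> W x y \<le> 1)"

text \<open>
  Finite simple graphs are taken with natural numbers as vertices, which covers every finite
  simple graph up to isomorphism; edges are two-element sets of vertices.
\<close>

definition finite_simple_graph :: "nat set \<Rightarrow> nat set set \<Rightarrow> bool" where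
  "finite_simple_graph V E \<longleftrightarrow> finite V \<and> E \<subseteq> {e. e \<subseteq> V \<and> card e = 2}"

text \<open>
  An edge \<open>e = {i, j}\<close> contributes the factor \<open>W (x i) (x j)\<close>. The endpoints are listed in
  increasing order; by symmetry of a graphon the order is irrelevant.
\<close>

definition hom_density ::
    "nat set \<Rightarrow> nat set set \<Rightarrow> 'a measure \<Rightarrow> ('a \<Rightarrow> 'a \<Rightarrow> real) \<Rightarrow> real" where
  "hom_density V E M W =
     (\<integral>x. (\<Prod>e\<in>E. W (x (Min e)) (x (Max e))) \<partial>(\<Pi>\<^sub>M i\<in>V. M))"

definition graphon_equivalent ::
    "'a measure \<Rightarrow> ('a \<Rightarrow> 'a \<Rightarrow> real) \<Rightarrow> 'b measure \<Rightarrow> ('b \<Rightarrow> 'b \<Rightarrow> real) \<Rightarrow> bool" where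
  "graphon_equivalent M\<^sub>1 W\<^sub>1 M\<^sub>2 W\<^sub>2 \<longleftrightarrow>
     (\<forall>V E. finite_simple_graph V E \<longrightarrow> hom_density V E M\<^sub>1 W\<^sub>1 = hom_density V E M\<^sub>2 W\<^sub>2)"

section \<open>Hoelder continuity\<close>

definition holder_on :: "real \<Rightarrow> 'a::euclidean_space set \<Rightarrow> ('a \<Rightarrow> real) \<Rightarrow> bool" where
  "holder_on \<alpha> D f \<longleftrightarrow>
     (\<exists>C. \<forall>x\<in>D. \<forall>y\<in>D. \<bar>f x - f y\<bar> \<le> C * norm (x - y) powr \<alpha>)"

text \<open>
  The norm on a product type is the Euclidean one, so that \<open>D \<times> D\<close> carries the metric of
  the Euclidean space of twice the dimension.
\<close>

definition holder_graphon_on ::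
    "real \<Rightarrow> 'a::euclidean_space set \<Rightarrow> ('a \<Rightarrow> 'a \<Rightarrow> real) \<Rightarrow> bool" where
  "holder_graphon_on \<alpha> D W \<longleftrightarrow> holder_on \<alpha> (D \<times> D) (\<lambda>(x, y). W x y)"

section \<open>Unit cubes and the lacunary cosine series\<close>

definition unit_cube :: "(real ^ 'd) set" where
  "unit_cube = {x. \<forall>i. 0 \<le> x $ i \<and> x $ i \<le> 1}"

text \<open>
  Lebesgue measure on \<open>D\<close>, on its Borel sets. For Hoelder functions, being continuous, it
  makes no difference whether Borel or Lebesgue measurable sets are used.
\<close>

definition leb :: "'a::euclidean_space set \<Rightarrow> 'a measure" where
  "leb D = restrict_space lborel D"

definition lacunary_cos :: "real \<Rightarrow> real \<Rightarrow> real" where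
  "lacunary_cos \<alpha> t = (\<Sum>k. 2 powr (- real k * \<alpha>) * cos (2 * pi * 2 ^ k * t))"

end

(*
  Let T be the integral operator of a graphon W, let S = 1 - T^2, and put f = W(., x) - W(., y).
  The truncated squared distance P_N(x, y) = <f, f> - <S^N f, f> increases, as N grows through
  the even numbers, to the squared L^2 distance of f from the kernel of T. Expanding S^N shows
  that P_N is a linear combination of densities of walks of length at least 4 between the roots
  x and y, so for independent x and y every moment of P_N(x, y) is a combination of densities of
  simple graphs. Hence the moments E (1 - P_N)^n agree for equivalent graphons.

  For a Hoelder(beta) graphon on [0,1], P_N(x, y) <= |f|^2 = O(|x - y|^(2 beta)), so P_N is small
  with comparatively large probability. For the lacunary graphon, z |-> cos(2 pi 2^k z_i - theta)
  is an eigenfunction with eigenvalue mu_k = a 2^(-k alpha) / 2, and testing f against it gives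
  P_N >= mu_k^2 (N large) unless cos(2 pi 2^k (x_i - y_i)) > 0. So P_N < mu_K^2 forces every
  x_i - y_i to lie within 2^(-K) / 4 of an integer, which has probability O(2^(-K d)).
  Taking n slightly larger than mu_K^(-2) contradicts beta > alpha / d as K grows.
*)
theory Submission
  imports Defs "HOL-Probability.Infinite_Product_Measure" "HOL-Real_Asymp.Real_Asymp"
begin

text \<open>The obstacle is \<open>ip f f\<close>: it contains closed walks of length two, that is
  double edges, which are not densities of simple graphs. Every term of \<open>1 - S^N\<close> has a
  factor T^2, so the shortest closed walk is a 4-cycle. On an eigenvalue \<mu> of T,
  \<open>1 - S^N\<close> takes the value \<open>1 - (1 - \<mu>^2)^N\<close>, which lies in [0, 1]
  and tends to 1 unless \<mu> is 0 (for \<mu>^2 \<le> 1). The single term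
  \<open>ip (T (T f)) f\<close> would be admissible too, but it weights an eigendirection by another
  \<mu>^2, and the same argument would exclude only \<beta> > 2 \<alpha> / d. Only polynomials in
  P_N can be compared, so \<open>(1 - P_N)^n\<close> serves as a smooth indicator of P_N being at
  most of order 1 / n. For 1 / n near mu_K^2, of order 2^(-2 K \<alpha>), this has probability at
  least about 2^(-K \<alpha> / \<beta>) on the interval, against 2^(-K d) on the cube. Neither a
  spectral theorem nor a measure-preserving coupling of equivalent graphons enters: explicit
  eigenfunctions are tested one at a time.\<close>

section \<open>Bounded measurable functions and their integrals\<close>

definition bounded_measurable :: "'a measure \<Rightarrow> ('a \<Rightarrow> real) \<Rightarrow> bool" where
  "bounded_measurable M g \<longleftrightarrow> g \<in> borel_measurable M \<and> (\<exists>B. \<forall>x\<in>space M. \<bar>g x\<bar> \<le> B)"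

lemma bounded_measurableI:
  "g \<in> borel_measurable M \<Longrightarrow> (\<And>x. x \<in> space M \<Longrightarrow> \<bar>g x\<bar> \<le> B) \<Longrightarrow> bounded_measurable M g"
  unfolding bounded_measurable_def by blast

lemma bounded_measurable_measurable [measurable_dest]:
  "bounded_measurable M g \<Longrightarrow> g \<in> borel_measurable M"
  by (simp add: bounded_measurable_def)

lemma bounded_measurable_const [simp, intro]: "bounded_measurable M (\<lambda>x. c)"
  by (auto simp: bounded_measurable_def)

lemma bounded_measurable_add [intro]:
  assumes "bounded_measurable M g" "bounded_measurable M h"
  shows "bounded_measurable M (\<lambda>x. g x + h x)"
proof -
  obtain B C where "\<forall>x\<in>space M. \<bar>g x\<bar> \<le> B" "\<forall>x\<in>space M. \<bar>h x\<bar> \<le> C"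
    using assms by (auto simp: bounded_measurable_def)
  then have "\<forall>x\<in>space M. \<bar>g x + h x\<bar> \<le> B + C" by fastforce
  then show ?thesis using assms by (auto simp: bounded_measurable_def)
qed

lemma bounded_measurable_mult [intro]:
  assumes "bounded_measurable M g" "bounded_measurable M h"
  shows "bounded_measurable M (\<lambda>x. g x * h x)"
proof -
  obtain B C where BC: "\<forall>x\<in>space M. \<bar>g x\<bar> \<le> B" "\<forall>x\<in>space M. \<bar>h x\<bar> \<le> C"
    using assms by (auto simp: bounded_measurable_def)
  then have "\<bar>g x * h x\<bar> \<le> B * C" if "x \<in> space M" for x
    using that unfolding abs_mult by (intro mult_mono) (auto intro: order_trans[OF abs_ge_zero])
  then show ?thesis using assms by (auto simp: bounded_measurable_def)
qed

lemma bounded_measurable_diff [intro]: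
  assumes "bounded_measurable M g" "bounded_measurable M h"
  shows "bounded_measurable M (\<lambda>x. g x - h x)"
  using bounded_measurable_add[OF assms(1) bounded_measurable_mult[OF bounded_measurable_const[of M "-1"] assms(2)]]
  by simp

lemma bounded_measurable_prod:
  assumes "finite I" "\<And>i. i \<in> I \<Longrightarrow> bounded_measurable M (f i)"
  shows "bounded_measurable M (\<lambda>x. \<Prod>i\<in>I. f i x)"
  using assms by (induction rule: finite_induct) auto

lemma bounded_measurable_compose:
  assumes "bounded_measurable N g" "X \<in> measurable M N"
  shows "bounded_measurable M (\<lambda>x. g (X x))"
proof -
  obtain B where "\<forall>x\<in>space N. \<bar>g x\<bar> \<le> B" "g \<in> borel_measurable N"
    using assms(1) by (auto simp: bounded_measurable_def)
  then show ?thesis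
    using measurable_space[OF assms(2)] measurable_compose[OF assms(2)]
    by (intro bounded_measurableI[of _ _ B]) auto
qed

context finite_measure
begin

lemma bounded_measurable_integrable:
  assumes "bounded_measurable M g"
  shows "integrable M g"
proof -
  obtain B where "\<forall>x\<in>space M. \<bar>g x\<bar> \<le> B" using assms by (auto simp: bounded_measurable_def)
  then show ?thesis
    using assms by (intro integrable_const_bound[where B=B]) (auto simp: bounded_measurable_def)
qed

end

context prob_space
begin

text \<open>The difference of the two sides is the variance of \<open>g\<close>.\<close>

lemma power2_integral_le:
  fixes g :: "'a \<Rightarrow> real"
  assumes "bounded_measurable M g"
  shows "(\<integral>x. g x \<partial>M)\<^sup>2 \<le> (\<integral>x. g x * g x \<partial>M)"
proof -
  define m where "m = (\<integral>x. g x \<partial>M)"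
  have i1: "integrable M g" "integrable M (\<lambda>x. g x * g x)"
    using assms by (auto intro: bounded_measurable_integrable)
  have "0 \<le> (\<integral>x. (g x - m)\<^sup>2 \<partial>M)" by simp
  also have "\<dots> = (\<integral>x. g x * g x - 2 * m * g x + m * m \<partial>M)"
    by (intro Bochner_Integration.integral_cong) (auto simp: power2_eq_square algebra_simps)
  also have "\<dots> = (\<integral>x. g x * g x \<partial>M) - m * m"
    using i1 by (simp add: m_def[symmetric] prob_space)
  finally show ?thesis by (simp add: m_def power2_eq_square)
qed

lemma integral_between_0_1:
  fixes g :: "'a \<Rightarrow> real"
  assumes "g \<in> borel_measurable M" "\<And>x. x \<in> space M \<Longrightarrow> 0 \<le> g x \<and> g x \<le> 1"
  shows "0 \<le> (\<integral>x. g x \<partial>M) \<and> (\<integral>x. g x \<partial>M) \<le> 1"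
proof
  show "0 \<le> (\<integral>x. g x \<partial>M)"
    using assms(2) by (intro integral_nonneg_AE AE_I2) auto
  have "integrable M g"
    using assms by (intro bounded_measurable_integrable bounded_measurableI[of _ _ 1]) auto
  then show "(\<integral>x. g x \<partial>M) \<le> 1"
    using integral_le_const[of g 1] assms(2) by (simp add: AE_I2)
qed

end

section \<open>The integral operator of a graphon\<close>

definition kernel_op :: "'a measure \<Rightarrow> ('a \<Rightarrow> 'a \<Rightarrow> real) \<Rightarrow> ('a \<Rightarrow> real) \<Rightarrow> 'a \<Rightarrow> real" where
  "kernel_op M W g u = (\<integral>z. W u z * g z \<partial>M)"

text \<open>The index counts interior vertices: \<open>walk M W n\<close> belongs to walks with n +
  1 edges and is the kernel of the operator's power n + 1.\<close>

definition walk :: "'a measure \<Rightarrow> ('a \<Rightarrow> 'a \<Rightarrow> real) \<Rightarrow> nat \<Rightarrow> 'a \<Rightarrow> 'a \<Rightarrow> real" where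
  "walk M W n u v = (kernel_op M W ^^ n) (\<lambda>z. W z v) u"

lemma walk_0: "walk M W 0 = W"
  by (simp add: walk_def fun_eq_iff)

lemma walk_Suc: "walk M W (Suc n) u v = (\<integral>z. W u z * walk M W n z v \<partial>M)"
  by (simp add: walk_def kernel_op_def)

locale graphon_space = prob_space M for M :: "'a measure" +
  fixes W :: "'a \<Rightarrow> 'a \<Rightarrow> real"
  assumes W_measurable: "(\<lambda>p. W (fst p) (snd p)) \<in> borel_measurable (M \<Otimes>\<^sub>M M)"
    and W_sym: "x \<in> space M \<Longrightarrow> y \<in> space M \<Longrightarrow> W x y = W y x"
    and W_nonneg: "x \<in> space M \<Longrightarrow> y \<in> space M \<Longrightarrow> 0 \<le> W x y"
    and W_le_1: "x \<in> space M \<Longrightarrow> y \<in> space M \<Longrightarrow> W x y \<le> 1"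

lemma graphon_imp_graphon_space: "graphon M W \<Longrightarrow> graphon_space M W"
  by (auto simp: graphon_def graphon_space_def graphon_space_axioms_def case_prod_beta)

context graphon_space
begin

sublocale MM: pair_prob_space M M ..

lemma measurable_W [measurable (raw)]:
  assumes "f \<in> measurable N M" "g \<in> measurable N M"
  shows "(\<lambda>x. W (f x) (g x)) \<in> borel_measurable N"
  using measurable_compose[OF measurable_Pair[OF assms] W_measurable] by simp

abbreviation T where "T \<equiv> kernel_op M W"

text \<open>T may have negative eigenvalues but has norm at most 1; squaring it makes 0 \<le> S
  \<le> 1 in the operator sense.\<close>

definition S where "S g = (\<lambda>u. g u - T (T g) u)"

definition ip :: "('a \<Rightarrow> real) \<Rightarrow> ('a \<Rightarrow> real) \<Rightarrow> real" where
  "ip g h = (\<integral>z. g z * h z \<partial>M)"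

lemma bounded_measurable_W: "u \<in> space M \<Longrightarrow> bounded_measurable M (W u)"
  using W_nonneg W_le_1 by (intro bounded_measurableI[of _ _ 1]) auto

lemma bounded_measurable_W': "v \<in> space M \<Longrightarrow> bounded_measurable M (\<lambda>z. W z v)"
  using W_nonneg W_le_1 by (intro bounded_measurableI[of _ _ 1]) auto

lemma integrable_bm: "bounded_measurable M g \<Longrightarrow> integrable M g"
  by (rule bounded_measurable_integrable)

text \<open>Functions are controlled on \<open>space M\<close> only, so congruence rules replace
  equality of functions. Since \<open>T\<close> merely integrates its argument, the results agree
  everywhere here; \<open>S\<close> also evaluates its argument and gives less.\<close>

lemma T_cong: "(\<And>z. z \<in> space M \<Longrightarrow> g z = h z) \<Longrightarrow> T g = T h"
  unfolding kernel_op_def fun_eq_iff by (auto intro!: Bochner_Integration.integral_cong)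

lemma S_cong: "(\<And>z. z \<in> space M \<Longrightarrow> g z = h z) \<Longrightarrow> u \<in> space M \<Longrightarrow> S g u = S h u"
  using T_cong[of g h] by (simp add: S_def)

lemma ip_cong:
  "(\<And>z. z \<in> space M \<Longrightarrow> g z = g' z) \<Longrightarrow> (\<And>z. z \<in> space M \<Longrightarrow> h z = h' z) \<Longrightarrow> ip g h = ip g' h'"
  unfolding ip_def by (auto intro!: Bochner_Integration.integral_cong)

lemma bm_T:
  assumes "bounded_measurable M g"
  shows "bounded_measurable M (T g)"
proof -
  obtain B where B: "\<forall>x\<in>space M. \<bar>g x\<bar> \<le> B" using assms by (auto simp: bounded_measurable_def)
  have [measurable]: "g \<in> borel_measurable M" using assms by (simp add: bounded_measurable_def)
  show ?thesis
  proof (rule bounded_measurableI)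
    show "T g \<in> borel_measurable M"
      unfolding kernel_op_def by measurable
    fix u assume u: "u \<in> space M"
    have "\<bar>T g u\<bar> \<le> (\<integral>z. \<bar>W u z * g z\<bar> \<partial>M)"
      unfolding kernel_op_def by simp
    also have "\<dots> \<le> B"
    proof (rule integral_le_const)
      show "integrable M (\<lambda>z. \<bar>W u z * g z\<bar>)"
        using assms bounded_measurable_W[OF u] by (intro integrable_abs integrable_bm) auto
      have "\<bar>W u z * g z\<bar> \<le> 1 * B" if "z \<in> space M" for z
        unfolding abs_mult using B that u W_nonneg W_le_1 by (intro mult_mono) auto
      then show "AE z in M. \<bar>W u z * g z\<bar> \<le> B" by (intro AE_I2) simp
    qed
    finally show "\<bar>T g u\<bar> \<le> B" .
  qed
qed

lemma bm_T_pow: "bounded_measurable M g \<Longrightarrow> bounded_measurable M ((T ^^ n) g)"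
  by (induction n) (auto intro: bm_T)

lemma bm_S: "bounded_measurable M g \<Longrightarrow> bounded_measurable M (S g)"
  unfolding S_def by (intro bounded_measurable_diff bm_T)

lemma bm_S_pow: "bounded_measurable M g \<Longrightarrow> bounded_measurable M ((S ^^ n) g)"
  by (induction n) (auto intro: bm_S)

text \<open>The combination \<open>g + c * h\<close> covers sums, differences
  (\<open>c = -1\<close>) and multiples (\<open>g = 0\<close>) at once.\<close>

lemma T_add_scale:
  assumes "bounded_measurable M g" "bounded_measurable M h" "u \<in> space M"
  shows "T (\<lambda>z. g z + c * h z) u = T g u + c * T h u"
proof -
  have "integrable M (\<lambda>z. W u z * g z)" "integrable M (\<lambda>z. W u z * h z)"
    using assms bounded_measurable_W by (auto intro!: integrable_bm)
  then have "(\<integral>z. W u z * g z + c * (W u z * h z) \<partial>M) = T g u + c * T h u"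
    by (simp add: kernel_op_def)
  then show ?thesis by (simp add: kernel_op_def algebra_simps)
qed

lemma T_pow_add_scale:
  assumes "bounded_measurable M g" "bounded_measurable M h" "u \<in> space M"
  shows "(T ^^ n) (\<lambda>z. g z + c * h z) u = (T ^^ n) g u + c * (T ^^ n) h u"
  using assms(3)
proof (induction n arbitrary: u)
  case (Suc n)
  then show ?case
    using T_cong[OF Suc.IH] T_add_scale[OF bm_T_pow bm_T_pow] assms by simp
qed simp

lemma S_add_scale:
  assumes "bounded_measurable M g" "bounded_measurable M h" "u \<in> space M"
  shows "S (\<lambda>z. g z + c * h z) u = S g u + c * S h u"
  using T_pow_add_scale[OF assms, of 2 c] by (simp add: S_def numeral_2_eq_2 algebra_simps)

lemma S_pow_add_scale:
  assumes "bounded_measurable M g" "bounded_measurable M h" "u \<in> space M"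
  shows "(S ^^ n) (\<lambda>z. g z + c * h z) u = (S ^^ n) g u + c * (S ^^ n) h u"
  using assms(3)
proof (induction n arbitrary: u)
  case (Suc n)
  then show ?case
    using S_cong[OF Suc.IH Suc.prems] S_add_scale[OF bm_S_pow bm_S_pow] assms by simp
qed simp

lemma ip_commute: "ip g h = ip h g"
  by (simp add: ip_def mult.commute)

lemma ip_add_scale:
  assumes "bounded_measurable M g" "bounded_measurable M h" "bounded_measurable M k"
  shows "ip (\<lambda>z. g z + c * h z) k = ip g k + c * ip h k"
proof -
  have "integrable M (\<lambda>z. g z * k z)" "integrable M (\<lambda>z. h z * k z)"
    using assms by (auto intro!: integrable_bm)
  then have "(\<integral>z. g z * k z + c * (h z * k z) \<partial>M) = ip g k + c * ip h k"
    by (simp add: ip_def)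
  then show ?thesis by (simp add: ip_def algebra_simps)
qed

lemma ip_diff:
  assumes "bounded_measurable M g" "bounded_measurable M h" "bounded_measurable M k"
  shows "ip (\<lambda>z. g z - h z) k = ip g k - ip h k"
  using ip_add_scale[OF assms, of "-1"] by simp

lemma ip_self_nonneg: "0 \<le> ip g g"
  by (simp add: ip_def)

lemma ip_T_sym:
  assumes "bounded_measurable M g" "bounded_measurable M h"
  shows "ip (T g) h = ip g (T h)"
proof -
  have [measurable]: "g \<in> borel_measurable M" "h \<in> borel_measurable M"
    using assms by (simp_all add: bounded_measurable_def)
  have *: "bounded_measurable (M \<Otimes>\<^sub>M M) (\<lambda>p. W (fst p) (snd p) * g (snd p) * h (fst p))"
    using assms
    by (intro bounded_measurable_mult bounded_measurable_compose[OF assms(1)]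
        bounded_measurable_compose[OF assms(2)] bounded_measurableI[of _ _ 1])
      (auto simp: space_pair_measure W_nonneg W_le_1)
  have "ip (T g) h = (\<integral>u. (\<integral>z. W u z * g z * h u \<partial>M) \<partial>M)"
    by (simp add: ip_def kernel_op_def)
  also have "\<dots> = (\<integral>z. (\<integral>u. W u z * g z * h u \<partial>M) \<partial>M)"
    using MM.bounded_measurable_integrable[OF *]
    by (intro MM.Fubini_integral[symmetric]) (simp add: case_prod_beta')
  also have "\<dots> = (\<integral>z. g z * (\<integral>u. W z u * h u \<partial>M) \<partial>M)"
  proof (rule Bochner_Integration.integral_cong[OF refl])
    fix z assume "z \<in> space M"
    then have "(\<integral>u. W u z * g z * h u \<partial>M) = (\<integral>u. g z * (W z u * h u) \<partial>M)"
      by (intro Bochner_Integration.integral_cong) (auto simp: W_sym)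
    then show "(\<integral>u. W u z * g z * h u \<partial>M) = g z * (\<integral>u. W z u * h u \<partial>M)" by simp
  qed
  also have "\<dots> = ip g (T h)" by (simp add: ip_def kernel_op_def)
  finally show ?thesis .
qed

text \<open>Since 0 \<le> W \<le> 1, the variance inequality bounds the square of \<open>T g\<close>
  by \<open>ip g g\<close> pointwise, and \<open>M\<close> has total mass 1.\<close>

lemma ip_T_le:
  assumes "bounded_measurable M g"
  shows "ip (T g) (T g) \<le> ip g g"
proof -
  have "T g u * T g u \<le> ip g g" if u: "u \<in> space M" for u
  proof -
    have b: "bounded_measurable M (\<lambda>z. W u z * g z)"
      using assms u bounded_measurable_W by auto
    have "T g u * T g u \<le> (\<integral>z. (W u z * g z) * (W u z * g z) \<partial>M)"
      using power2_integral_le[OF b] by (simp add: kernel_op_def power2_eq_square)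
    also have "\<dots> \<le> ip g g"
      unfolding ip_def
    proof (rule integral_mono)
      show "integrable M (\<lambda>z. (W u z * g z) * (W u z * g z))" using b by (auto intro: integrable_bm)
      show "integrable M (\<lambda>z. g z * g z)" using assms by (auto intro: integrable_bm)
      fix z assume z: "z \<in> space M"
      have "(W u z)\<^sup>2 \<le> 1" using u z W_nonneg W_le_1 by (simp add: power_le_one)
      then have "(W u z)\<^sup>2 * (g z)\<^sup>2 \<le> 1 * (g z)\<^sup>2" by (intro mult_right_mono) auto
      then show "W u z * g z * (W u z * g z) \<le> g z * g z" by (simp add: power2_eq_square ac_simps)
    qed
    finally show ?thesis .
  qed
  moreover have "integrable M (\<lambda>u. T g u * T g u)" using assms bm_T by (auto intro!: integrable_bm)
  ultimately show ?thesis
    using integral_le_const[of "\<lambda>u. T g u * T g u" "ip g g"] by (simp add: ip_def AE_I2)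
qed

lemma ip_S_sym:
  assumes "bounded_measurable M g" "bounded_measurable M h"
  shows "ip (S g) h = ip g (S h)"
proof -
  have "ip (S g) h = ip g h - ip (T (T g)) h"
    unfolding S_def using assms by (intro ip_diff bm_T)
  also have "ip (T (T g)) h = ip g (T (T h))"
    using assms by (simp add: ip_T_sym bm_T)
  also have "\<dots> = ip (T (T h)) g" by (rule ip_commute)
  also have "ip g h - ip (T (T h)) g = ip (S h) g"
    unfolding S_def using assms by (subst ip_diff) (auto intro: bm_T simp: ip_commute)
  finally show ?thesis by (simp add: ip_commute)
qed

lemma ip_S_pow_sym:
  assumes "bounded_measurable M g" "bounded_measurable M h"
  shows "ip ((S ^^ n) g) h = ip g ((S ^^ n) h)"
  using assms
proof (induction n arbitrary: h)
  case (Suc n)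
  then have "ip ((S ^^ Suc n) g) h = ip ((S ^^ n) g) (S h)" by (simp add: ip_S_sym bm_S_pow)
  also have "\<dots> = ip g ((S ^^ n) (S h))" using Suc by (simp add: bm_S)
  finally show ?case by (simp add: funpow_swap1)
qed simp

text \<open>By symmetry of T the left side expands to |g|^2 - 2 |T g|^2 + |T^2 g|^2, whose last term
  is at most |T g|^2.\<close>

lemma ip_S_le:
  assumes "bounded_measurable M g"
  shows "ip (S g) (S g) \<le> ip g g"
proof -
  note b = assms bm_T[OF assms] bm_T[OF bm_T[OF assms]] bm_S[OF assms]
  have "ip (S g) (S g) = ip g (S g) - ip (T (T g)) (S g)"
    using ip_diff[of g "T (T g)" "S g"] b by (simp add: S_def)
  also have "ip g (S g) = ip g g - ip g (T (T g))"
    using ip_diff[of g "T (T g)" g] b by (simp add: S_def ip_commute)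
  also have "ip (T (T g)) (S g) = ip (T (T g)) g - ip (T (T g)) (T (T g))"
    using ip_diff[of g "T (T g)" "T (T g)"] b by (simp add: S_def ip_commute)
  finally have "ip (S g) (S g) = ip g g - 2 * ip (T g) (T g) + ip (T (T g)) (T (T g))"
    using ip_T_sym[of g "T g"] b by (simp add: ip_commute)
  then show ?thesis using ip_T_le[of "T g"] ip_self_nonneg[of "T g"] b by simp
qed

lemma ip_S_pow_le:
  assumes "bounded_measurable M g"
  shows "ip ((S ^^ n) g) ((S ^^ n) g) \<le> ip g g"
  using ip_S_le[OF bm_S_pow[OF assms]] by (induction n) (auto intro: order_trans)

text \<open>The reason for even exponents: the quadratic form becomes a squared norm, to which
  contraction and Pythagoras apply.\<close>

lemma ip_S_pow_double:
  assumes "bounded_measurable M g"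
  shows "ip ((S ^^ (2 * n)) g) g = ip ((S ^^ n) g) ((S ^^ n) g)"
  using ip_S_pow_sym[OF bm_S_pow[OF assms, of n] assms, of n]
  by (simp add: mult_2 funpow_add)

text \<open>Split \<open>f\<close> into its projection on \<open>e\<close> and a remainder
  \<open>f'\<close>. Powers of S keep the two parts orthogonal, multiply the first by
  \<open>(1 - \<mu>^2)^n\<close> and do not lengthen the second. One eigenfunction is enough; no
  eigenbasis is involved.\<close>

lemma ip_S_pow_eigen:
  assumes f: "bounded_measurable M f" and e: "bounded_measurable M e"
    and eig: "\<And>u. u \<in> space M \<Longrightarrow> T e u = \<mu> * e u"
    and pos: "ip e e > 0"
  shows "ip ((S ^^ n) f) ((S ^^ n) f)
    \<le> ip f f - (1 - (1 - \<mu>\<^sup>2) ^ (2 * n)) * (ip f e)\<^sup>2 / ip e e"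
proof -
  define c where "c = ip f e / ip e e"
  define f' where "f' = (\<lambda>z. f z + (- c) * e z)"
  have f': "bounded_measurable M f'"
    unfolding f'_def using f e by (intro bounded_measurable_add bounded_measurable_mult) auto
  have "T (T e) u = \<mu>\<^sup>2 * e u" if u: "u \<in> space M" for u
  proof -
    have "T (T e) u = T (\<lambda>z. 0 + \<mu> * e z) u"
      using T_cong[of "T e" "\<lambda>z. 0 + \<mu> * e z"] eig by simp
    also have "\<dots> = \<mu> * T e u" using T_add_scale[of "\<lambda>z. 0" e u \<mu>] e u by (simp add: kernel_op_def)
    finally show ?thesis using eig[OF u] by (simp add: power2_eq_square)
  qed
  then have Se: "S e u = 0 + (1 - \<mu>\<^sup>2) * e u" if "u \<in> space M" for u
    using that by (simp add: S_def algebra_simps)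
  define \<kappa> where "\<kappa> = 1 - \<mu>\<^sup>2"
  have S0: "S (\<lambda>z. 0) = (\<lambda>z. 0)" by (simp add: S_def kernel_op_def)
  have Spe: "(S ^^ n) e u = \<kappa> ^ n * e u" if "u \<in> space M" for u n
    using that
  proof (induction n arbitrary: u)
    case (Suc n)
    have "(S ^^ Suc n) e u = S (\<lambda>z. 0 + \<kappa> ^ n * e z) u"
      using S_cong[of "(S ^^ n) e" "\<lambda>z. 0 + \<kappa> ^ n * e z"] Suc by simp
    also have "\<dots> = \<kappa> ^ n * S e u"
      using S_add_scale[of "\<lambda>z. 0" e u "\<kappa> ^ n"] e Suc.prems by (simp add: S0)
    finally show ?case using Se[OF Suc.prems] by (simp add: \<kappa>_def)
  qed simp
  have f'e: "ip f' e = 0"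
    unfolding f'_def using ip_add_scale[OF f e e, of "-c"] pos by (simp add: c_def)
  have split: "(S ^^ n) f u = (S ^^ n) f' u + (c * \<kappa> ^ n) * e u" if u: "u \<in> space M" for u
  proof -
    have "f = (\<lambda>z. f' z + c * e z)" by (simp add: f'_def)
    then have "(S ^^ n) f u = (S ^^ n) (\<lambda>z. f' z + c * e z) u" by simp
    also have "\<dots> = (S ^^ n) f' u + c * (S ^^ n) e u" using f' e u by (rule S_pow_add_scale)
    finally show ?thesis using Spe u by simp
  qed
  have orth: "ip ((S ^^ n) f') e = 0"
  proof -
    have "ip ((S ^^ n) f') e = ip f' ((S ^^ n) e)" using f' e by (rule ip_S_pow_sym)
    also have "\<dots> = ip ((S ^^ n) e) f'" by (rule ip_commute)
    also have "\<dots> = ip (\<lambda>z. 0 + \<kappa> ^ n * e z) f'" by (rule ip_cong) (auto simp: Spe)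
    also have "\<dots> = 0" using f' e f'e by (subst ip_add_scale) (auto simp: ip_def mult.commute)
    finally show ?thesis .
  qed
  have pyth: "ip (\<lambda>z. g z + s * e z) (\<lambda>z. g z + s * e z) = ip g g + s\<^sup>2 * ip e e"
    if g: "bounded_measurable M g" and "ip g e = 0" for g s
  proof -
    have gs: "bounded_measurable M (\<lambda>z. g z + s * e z)"
      using g e by (intro bounded_measurable_add bounded_measurable_mult bounded_measurable_const)
    have "ip (\<lambda>z. g z + s * e z) (\<lambda>z. g z + s * e z)
        = ip g (\<lambda>z. g z + s * e z) + s * ip e (\<lambda>z. g z + s * e z)"
      by (rule ip_add_scale[OF g e gs])
    also have "ip g (\<lambda>z. g z + s * e z) = ip g g + s * ip e g"
      using ip_add_scale[OF g e g, of s] ip_commute[of g "\<lambda>z. g z + s * e z"] by simp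
    also have "ip e (\<lambda>z. g z + s * e z) = ip g e + s * ip e e"
      using ip_add_scale[OF g e e, of s] ip_commute[of e "\<lambda>z. g z + s * e z"] by simp
    finally show ?thesis using that(2) by (simp add: ip_commute[of e g] power2_eq_square)
  qed
  have "ip ((S ^^ n) f) ((S ^^ n) f) = ip ((S ^^ n) f') ((S ^^ n) f') + (c * \<kappa> ^ n)\<^sup>2 * ip e e"
    using pyth[OF bm_S_pow[OF f'] orth, of "c * \<kappa> ^ n"] ip_cong[OF split split] by simp
  also have "\<dots> \<le> ip f' f' + (c * \<kappa> ^ n)\<^sup>2 * ip e e" using ip_S_pow_le[OF f'] by simp
  also have "ip f' f' = ip f f - c\<^sup>2 * ip e e"
    using pyth[OF f' f'e, of c] by (simp add: f'_def)
  also have "ip f f - c\<^sup>2 * ip e e + (c * \<kappa> ^ n)\<^sup>2 * ip e e = ip f f - (1 - \<kappa> ^ (2 * n)) * (c\<^sup>2 * ip e e)"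
    by (simp only: power_mult_distrib power_even_eq) (simp add: algebra_simps)
  also have "c\<^sup>2 * ip e e = (ip f e)\<^sup>2 / ip e e" using pos by (simp add: c_def power2_eq_square)
  finally show ?thesis by (simp add: \<kappa>_def)
qed

lemma eigenvalue_le_1:
  assumes e: "bounded_measurable M e"
    and eig: "\<And>u. u \<in> space M \<Longrightarrow> T e u = \<mu> * e u"
    and pos: "ip e e > 0"
  shows "\<mu>\<^sup>2 \<le> 1"
proof -
  have "\<mu>\<^sup>2 * ip e e = ip (T e) (T e)"
    using ip_cong[OF eig eig] by (simp add: ip_def power2_eq_square ac_simps)
  also have "\<dots> \<le> 1 * ip e e" using ip_T_le[OF e] by simp
  finally show ?thesis using pos by simp
qed

end

section \<open>Walk densities and simple graphs\<close>

definition edge_prod :: "('a \<Rightarrow> 'a \<Rightarrow> real) \<Rightarrow> nat set set \<Rightarrow> (nat \<Rightarrow> 'a) \<Rightarrow> real" where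
  "edge_prod W E w = (\<Prod>e\<in>E. W (w (Min e)) (w (Max e)))"

definition walk_prod ::
    "'a measure \<Rightarrow> ('a \<Rightarrow> 'a \<Rightarrow> real) \<Rightarrow> (nat \<times> nat \<times> nat) list \<Rightarrow> (nat \<Rightarrow> 'a) \<Rightarrow> real" where
  "walk_prod M W es w = prod_list (map (\<lambda>(u, v, l). walk M W l (w u) (w v)) es)"

text \<open>A mixed density: \<open>E\<close> holds explicit edges, \<open>es\<close> holds walks
  whose interior vertices are already integrated out. An empty list gives \<open>hom_density\<close>
  on \<open>{..<n}\<close>, an empty \<open>E\<close> a pure product of walks.\<close>

definition hom_walk ::
    "'a measure \<Rightarrow> ('a \<Rightarrow> 'a \<Rightarrow> real) \<Rightarrow> nat \<Rightarrow> nat set set \<Rightarrow> (nat \<times> nat \<times> nat) list \<Rightarrow> real" where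
  "hom_walk M W n E es = (\<integral>w. edge_prod W E w * walk_prod M W es w \<partial>(\<Pi>\<^sub>M i\<in>{..<n}. M))"

text \<open>
  A list entry \<open>(u, v, l)\<close> stands for a path with \<open>l + 1\<close> edges from \<open>u\<close> to \<open>v\<close>
  through \<open>l\<close> new vertices; the side conditions are what makes the resulting graph simple.
\<close>

definition simple_walks :: "nat \<Rightarrow> (nat \<times> nat \<times> nat) list \<Rightarrow> bool" where
  "simple_walks n es \<longleftrightarrow>
     (\<forall>(u, v, l)\<in>set es. u < n \<and> v < n \<and> 1 \<le> l \<and> (u = v \<longrightarrow> 2 \<le> l))"

lemma walk_prod_Cons:
  "walk_prod M W ((u, v, l) # es) w = walk M W l (w u) (w v) * walk_prod M W es w"
  by (simp add: walk_prod_def)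

lemma simple_walks_Cons:
  "simple_walks n ((u, v, l) # es) \<longleftrightarrow>
     u < n \<and> v < n \<and> 1 \<le> l \<and> (u = v \<longrightarrow> 2 \<le> l) \<and> simple_walks n es"
  by (auto simp: simple_walks_def)

lemma simple_walks_mono: "simple_walks n es \<Longrightarrow> n \<le> m \<Longrightarrow> simple_walks m es"
  by (force simp: simple_walks_def)

lemma finite_simple_graphD:
  assumes "finite_simple_graph V E" "e \<in> E"
  shows "Min e \<in> V" "Max e \<in> V" "e \<subseteq> V" "finite e" "e \<noteq> {}"
proof -
  have e: "e \<subseteq> V" "card e = 2" using assms by (auto simp: finite_simple_graph_def)
  then have fe: "finite e" "e \<noteq> {}" by (auto intro: card_ge_0_finite)
  show "Min e \<in> V" "Max e \<in> V" using Min_in[OF fe] Max_in[OF fe] e by auto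
  show "e \<subseteq> V" "finite e" "e \<noteq> {}" using e fe by auto
qed

lemma finite_simple_graph_finite: "finite_simple_graph V E \<Longrightarrow> finite E"
  unfolding finite_simple_graph_def by (rule finite_subset[of E "Pow V"]) auto

lemma finite_simple_graph_insert:
  assumes "finite_simple_graph V E" "u \<in> V'" "v \<in> V'" "u \<noteq> v" "V \<subseteq> V'" "finite V'"
  shows "finite_simple_graph V' (insert {u, v} E)"
  using assms by (auto simp: finite_simple_graph_def)

lemma edge_prod_update:
  assumes "finite_simple_graph {..<n} E"
  shows "edge_prod W E (w(n := z)) = edge_prod W E w"
  unfolding edge_prod_def using finite_simple_graphD(1,2)[OF assms]
  by (intro prod.cong refl) fastforce

lemma walk_prod_update:
  assumes "simple_walks n es"
  shows "walk_prod M W es (w(n := z)) = walk_prod M W es w"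
  using assms by (induction es) (auto simp: walk_prod_Cons simple_walks_Cons, simp add: walk_prod_def)

context graphon_space
begin

text \<open>Joint induction, because bounding the next integral needs the measurability of the
  current walk.\<close>

lemma walk_measurable_bounds:
  "(\<lambda>p. walk M W n (fst p) (snd p)) \<in> borel_measurable (M \<Otimes>\<^sub>M M) \<and>
   (\<forall>u\<in>space M. \<forall>v\<in>space M. 0 \<le> walk M W n u v \<and> walk M W n u v \<le> 1)"
proof (induction n)
  case 0
  then show ?case using W_measurable W_nonneg W_le_1 by (simp add: walk_0)
next
  case (Suc n)
  have m: "(\<lambda>x. walk M W n (f x) (g x)) \<in> borel_measurable N"
    if "f \<in> measurable N M" "g \<in> measurable N M" for f g and N :: "'c measure"
    using measurable_compose[OF measurable_Pair[OF that], of "\<lambda>p. walk M W n (fst p) (snd p)"] Suc by simp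
  have "0 \<le> walk M W (Suc n) u v \<and> walk M W (Suc n) u v \<le> 1"
    if "u \<in> space M" "v \<in> space M" for u v
    unfolding walk_Suc
  proof (rule integral_between_0_1)
    show "(\<lambda>z. W u z * walk M W n z v) \<in> borel_measurable M"
      using that by (intro borel_measurable_times measurable_W m) auto
    show "0 \<le> W u z * walk M W n z v \<and> W u z * walk M W n z v \<le> 1" if "z \<in> space M" for z
      using Suc that \<open>u \<in> space M\<close> \<open>v \<in> space M\<close> W_nonneg W_le_1 by (simp add: mult_le_one)
  qed
  moreover have "(\<lambda>p. walk M W (Suc n) (fst p) (snd p)) \<in> borel_measurable (M \<Otimes>\<^sub>M M)"
    unfolding walk_Suc
    by (intro borel_measurable_lebesgue_integral)
      (auto simp: case_prod_beta' intro!: borel_measurable_times measurable_W m)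
  ultimately show ?case by simp
qed

lemma walk_bounds:
  assumes "u \<in> space M" "v \<in> space M"
  shows "0 \<le> walk M W n u v" "walk M W n u v \<le> 1"
  using walk_measurable_bounds assms by auto

lemma measurable_walk [measurable (raw)]:
  assumes "f \<in> measurable N M" "g \<in> measurable N M"
  shows "(\<lambda>x. walk M W n (f x) (g x)) \<in> borel_measurable N"
  using measurable_compose[OF measurable_Pair[OF assms] walk_measurable_bounds[THEN conjunct1]] by simp

lemma bounded_measurable_walk:
  assumes "f \<in> measurable N M" "g \<in> measurable N M"
  shows "bounded_measurable N (\<lambda>x. walk M W n (f x) (g x))"
  using assms[THEN measurable_space] walk_bounds
  by (intro bounded_measurableI[of _ _ 1] measurable_walk assms) (auto simp: abs_le_iff intro: order_trans[of _ 0])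

sublocale PM: product_sigma_finite "\<lambda>_::nat. M" ..

lemma prob_space_power: "prob_space (\<Pi>\<^sub>M i\<in>I. M)"
  by (intro prob_space_PiM prob_space_axioms)

lemma bm_edge_prod:
  assumes "finite_simple_graph V E"
  shows "bounded_measurable (\<Pi>\<^sub>M i\<in>V. M) (edge_prod W E)"
proof -
  have "bounded_measurable (\<Pi>\<^sub>M i\<in>V. M) (\<lambda>w. W (w (Min e)) (w (Max e)))" if "e \<in> E" for e
    using bounded_measurable_walk[of "\<lambda>w. w (Min e)" _ "\<lambda>w. w (Max e)" 0] finite_simple_graphD[OF assms that]
    by (auto simp: walk_0)
  then show ?thesis
    unfolding edge_prod_def
    using finite_simple_graph_finite[OF assms] by (intro bounded_measurable_prod)
qed

lemma bm_walk_prod: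
  assumes "simple_walks n es"
  shows "bounded_measurable (\<Pi>\<^sub>M i\<in>{..<n}. M) (walk_prod M W es)"
  using assms
proof (induction es)
  case Nil
  then show ?case by (simp add: walk_prod_def)
next
  case (Cons e es)
  obtain u v l where e: "e = (u, v, l)" by (cases e)
  have "bounded_measurable (\<Pi>\<^sub>M i\<in>{..<n}. M) (\<lambda>w. walk M W l (w u) (w v))"
    using Cons.prems by (intro bounded_measurable_walk) (auto simp: e simple_walks_Cons)
  then show ?case
    using Cons by (auto simp: e simple_walks_Cons walk_prod_Cons[abs_def] intro!: bounded_measurable_mult)
qed

text \<open>New vertices always receive the next number, so Fubini only has to split off the last
  coordinate.\<close>

lemma integral_power_Suc:
  assumes "bounded_measurable (\<Pi>\<^sub>M i\<in>{..<Suc n}. M) f"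
  shows "(\<integral>w. f w \<partial>(\<Pi>\<^sub>M i\<in>{..<Suc n}. M)) = (\<integral>w. (\<integral>z. f (w(n := z)) \<partial>M) \<partial>(\<Pi>\<^sub>M i\<in>{..<n}. M))"
proof -
  interpret P: prob_space "\<Pi>\<^sub>M i\<in>{..<Suc n}. M" by (rule prob_space_power)
  show ?thesis
    using PM.product_integral_insert[of "{..<n}" n f] P.bounded_measurable_integrable[OF assms]
    by (simp add: lessThan_Suc)
qed

text \<open>A walk without interior vertices is an edge. It has to be new: \<open>edge_prod\<close>
  runs over a set and would count a repeated edge only once.\<close>

lemma hom_walk_insert_edge:
  assumes E: "finite_simple_graph {..<n} E" and uv: "u < n" "v < n" "u \<noteq> v" "{u, v} \<notin> E"
  shows "hom_walk M W n (insert {u, v} E) es = hom_walk M W n E ((u, v, 0) # es)"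
  unfolding hom_walk_def
proof (rule Bochner_Integration.integral_cong[OF refl])
  fix w assume w: "w \<in> space (\<Pi>\<^sub>M i\<in>{..<n}. M)"
  have sp: "w u \<in> space M" "w v \<in> space M" using w uv by (auto simp: space_PiM PiE_def Pi_def)
  have "W (w (Min {u, v})) (w (Max {u, v})) = W (w u) (w v)"
    using W_sym[OF sp] by (cases "u < v") (auto simp: min_def max_def)
  then show "edge_prod W (insert {u, v} E) w * walk_prod M W es w
      = edge_prod W E w * walk_prod M W ((u, v, 0) # es) w"
    using uv finite_simple_graph_finite[OF E] by (simp add: edge_prod_def walk_prod_Cons walk_0)
qed

text \<open>Undoes one integration of \<open>walk_Suc\<close>: the first interior vertex becomes the
  fresh explicit vertex n, joined to u by an explicit edge.\<close>

lemma hom_walk_Suc: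
  assumes E: "finite_simple_graph {..<n} E" and uv: "u < n" "v < n" and es: "simple_walks n es"
  shows "hom_walk M W n E ((u, v, Suc l) # es) = hom_walk M W (Suc n) (insert {u, n} E) ((n, v, l) # es)"
proof -
  have E': "finite_simple_graph {..<Suc n} (insert {u, n} E)"
    using E uv by (intro finite_simple_graph_insert[OF E]) auto
  have es': "simple_walks (Suc n) es" using simple_walks_mono[OF es] by simp
  have notin: "{u, n} \<notin> E" using finite_simple_graphD(3)[OF E, of "{u, n}"] by auto
  define f where "f w = edge_prod W (insert {u, n} E) w * walk_prod M W ((n, v, l) # es) w" for w
  have f: "bounded_measurable (\<Pi>\<^sub>M i\<in>{..<Suc n}. M) f"
    unfolding f_def walk_prod_Cons using uv
    by (intro bounded_measurable_mult bm_edge_prod E' bm_walk_prod es' bounded_measurable_walk) auto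
  have mm: "Min {u, n} = u" "Max {u, n} = n" using uv by (auto simp: min_def max_def)
  have "hom_walk M W (Suc n) (insert {u, n} E) ((n, v, l) # es) = (\<integral>w. (\<integral>z. f (w(n := z)) \<partial>M) \<partial>(\<Pi>\<^sub>M i\<in>{..<n}. M))"
    using integral_power_Suc[OF f] by (simp add: hom_walk_def f_def)
  also have "\<dots> = hom_walk M W n E ((u, v, Suc l) # es)"
    unfolding hom_walk_def
  proof (rule Bochner_Integration.integral_cong[OF refl])
    fix w
    have "f (w(n := z)) = edge_prod W E w * walk_prod M W es w * (W (w u) z * walk M W l z (w v))" for z
    proof -
      have "edge_prod W (insert {u, n} E) (w(n := z)) = W (w u) z * edge_prod W E (w(n := z))"
        using notin uv finite_simple_graph_finite[OF E] mm by (simp add: edge_prod_def)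
      then show ?thesis
        using uv by (simp add: f_def walk_prod_Cons edge_prod_update[OF E] walk_prod_update[OF es])
    qed
    then show "(\<integral>z. f (w(n := z)) \<partial>M) = edge_prod W E w * walk_prod M W ((u, v, Suc l) # es) w"
      by (simp add: walk_prod_Cons walk_Suc)
  qed
  finally show ?thesis ..
qed

end

section \<open>Equality of walk densities for equivalent graphons\<close>

locale equivalent_graphons =
  G1: graphon_space M\<^sub>1 W\<^sub>1 + G2: graphon_space M\<^sub>2 W\<^sub>2
  for M\<^sub>1 :: "'a measure" and W\<^sub>1 :: "'a \<Rightarrow> 'a \<Rightarrow> real"
    and M\<^sub>2 :: "'b measure" and W\<^sub>2 :: "'b \<Rightarrow> 'b \<Rightarrow> real" +
  assumes equivalent: "graphon_equivalent M\<^sub>1 W\<^sub>1 M\<^sub>2 W\<^sub>2"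
begin

text \<open>Induction on the total number of interior vertices. Each step makes one of them
  explicit, until a simple graph remains and equivalence applies.\<close>

lemma hom_walk_eq:
  assumes "finite_simple_graph {..<n} E" "simple_walks n es"
  shows "hom_walk M\<^sub>1 W\<^sub>1 n E es = hom_walk M\<^sub>2 W\<^sub>2 n E es"
  using assms
proof (induction "sum_list (map (\<lambda>(u, v, l). l) es)" arbitrary: n E es rule: less_induct)
  case less
  note E = less.prems(1)
  show ?case
  proof (cases es)
    case Nil
    then show ?thesis
      using equivalent E
      by (simp add: hom_walk_def walk_prod_def edge_prod_def graphon_equivalent_def hom_density_def)
  next
    case (Cons e es')
    then obtain u v l where es: "es = (u, v, Suc l) # es'"
      using less.prems(2) by (cases e; cases "snd (snd e)") (auto simp: simple_walks_Cons)
    have uv: "u < n" "v < n" "u = v \<longrightarrow> l \<ge> 1" and es': "simple_walks n es'"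
      using less.prems(2) by (auto simp: es simple_walks_Cons)
    let ?E = "insert {u, n} E"
    have E': "finite_simple_graph {..<Suc n} ?E"
      using E uv by (intro finite_simple_graph_insert[OF E]) auto
    have es'': "simple_walks (Suc n) es'" using simple_walks_mono[OF es'] by simp
    have "hom_walk M\<^sub>1 W\<^sub>1 (Suc n) ?E ((n, v, l) # es') = hom_walk M\<^sub>2 W\<^sub>2 (Suc n) ?E ((n, v, l) # es')"
    proof (cases "l = 0")
      case True
      \<comment> \<open>What is left of the walk is a single edge, which \<open>simple_walks\<close>
        does not admit, so it moves to the edge set at once. It is new there: n is fresh, and u
        differs from v because l = 0.\<close>
      have "{n, v} \<notin> E" using finite_simple_graphD(3)[OF E, of "{n, v}"] by auto
      then have "{n, v} \<notin> ?E" using True uv by (auto simp: doubleton_eq_iff)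
      moreover have "finite_simple_graph {..<Suc n} (insert {n, v} ?E)"
        using uv by (intro finite_simple_graph_insert[OF E']) auto
      ultimately show ?thesis
        using less.hyps[of es' "Suc n" "insert {n, v} ?E"] es'' uv True
          G1.hom_walk_insert_edge[OF E', of n v es'] G2.hom_walk_insert_edge[OF E', of n v es']
        by (simp add: es)
    next
      case False
      then show ?thesis
        using less.hyps[of "(n, v, l) # es'" "Suc n" ?E] E' es'' uv by (simp add: es simple_walks_Cons)
    qed
    then show ?thesis
      using G1.hom_walk_Suc[OF E uv(1,2) es', of l] G2.hom_walk_Suc[OF E uv(1,2) es', of l]
      by (simp add: es)
  qed
qed

section \<open>Functions of two roots, the coordinates 0 and 1\<close>

abbreviation "\<Omega>\<^sub>1 \<equiv> \<Pi>\<^sub>M i\<in>{..<2::nat}. M\<^sub>1"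
abbreviation "\<Omega>\<^sub>2 \<equiv> \<Pi>\<^sub>M i\<in>{..<2::nat}. M\<^sub>2"

sublocale P1: prob_space \<Omega>\<^sub>1 by (rule G1.prob_space_power)
sublocale P2: prob_space \<Omega>\<^sub>2 by (rule G2.prob_space_power)

text \<open>A weak form of agreement: no product of walk densities between the roots tells
  \<open>G\<close> and \<open>G'\<close> apart.\<close>

definition linked :: "((nat \<Rightarrow> 'a) \<Rightarrow> real) \<Rightarrow> ((nat \<Rightarrow> 'b) \<Rightarrow> real) \<Rightarrow> bool" where
  "linked G G' \<longleftrightarrow> bounded_measurable \<Omega>\<^sub>1 G \<and> bounded_measurable \<Omega>\<^sub>2 G' \<and>
     (\<forall>es. simple_walks 2 es \<longrightarrow>
        (\<integral>w. walk_prod M\<^sub>1 W\<^sub>1 es w * G w \<partial>\<Omega>\<^sub>1) = (\<integral>w. walk_prod M\<^sub>2 W\<^sub>2 es w * G' w \<partial>\<Omega>\<^sub>2))"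

text \<open>
  Quantifying over all linked partners makes this class closed under products without
  a normal form for polynomials in walk densities.
\<close>

definition invariant :: "((nat \<Rightarrow> 'a) \<Rightarrow> real) \<Rightarrow> ((nat \<Rightarrow> 'b) \<Rightarrow> real) \<Rightarrow> bool" where
  "invariant F F' \<longleftrightarrow> (\<forall>G G'. linked G G' \<longrightarrow> linked (\<lambda>w. F w * G w) (\<lambda>w. F' w * G' w))"

lemma linked_one: "linked (\<lambda>_. 1) (\<lambda>_. 1)"
  using hom_walk_eq[of 2 "{}"]
  by (auto simp: linked_def hom_walk_def edge_prod_def finite_simple_graph_def)

text \<open>Take the constant 1 as linked partner and test against the empty product.\<close>

lemma invariant_integral_eq:
  assumes "invariant F F'"
  shows "(\<integral>w. F w \<partial>\<Omega>\<^sub>1) = (\<integral>w. F' w \<partial>\<Omega>\<^sub>2)"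
proof -
  have "linked (\<lambda>w. F w * 1) (\<lambda>w. F' w * 1)"
    using assms linked_one unfolding invariant_def by blast
  then have "simple_walks 2 [] \<longrightarrow> (\<integral>w. walk_prod M\<^sub>1 W\<^sub>1 [] w * (F w * 1) \<partial>\<Omega>\<^sub>1)
      = (\<integral>w. walk_prod M\<^sub>2 W\<^sub>2 [] w * (F' w * 1) \<partial>\<Omega>\<^sub>2)"
    unfolding linked_def by blast
  then show ?thesis by (simp add: walk_prod_def simple_walks_def)
qed

lemma linked_add_scale:
  assumes "linked F F'" "linked G G'"
  shows "linked (\<lambda>w. F w + c * G w) (\<lambda>w. F' w + c * G' w)"
  unfolding linked_def
proof (intro conjI allI impI)
  note b = assms[unfolded linked_def]
  show "bounded_measurable \<Omega>\<^sub>1 (\<lambda>w. F w + c * G w)" "bounded_measurable \<Omega>\<^sub>2 (\<lambda>w. F' w + c * G' w)"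
    using b by (auto intro!: bounded_measurable_add bounded_measurable_mult)
  fix es assume es: "simple_walks 2 es"
  have i: "integrable \<Omega>\<^sub>1 (\<lambda>w. walk_prod M\<^sub>1 W\<^sub>1 es w * F w)" "integrable \<Omega>\<^sub>1 (\<lambda>w. walk_prod M\<^sub>1 W\<^sub>1 es w * G w)"
    "integrable \<Omega>\<^sub>2 (\<lambda>w. walk_prod M\<^sub>2 W\<^sub>2 es w * F' w)" "integrable \<Omega>\<^sub>2 (\<lambda>w. walk_prod M\<^sub>2 W\<^sub>2 es w * G' w)"
    using b es G1.bm_walk_prod G2.bm_walk_prod
    by (auto intro!: P1.bounded_measurable_integrable P2.bounded_measurable_integrable bounded_measurable_mult)
  have "(\<integral>w. walk_prod M\<^sub>1 W\<^sub>1 es w * F w + c * (walk_prod M\<^sub>1 W\<^sub>1 es w * G w) \<partial>\<Omega>\<^sub>1)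
      = (\<integral>w. walk_prod M\<^sub>2 W\<^sub>2 es w * F' w + c * (walk_prod M\<^sub>2 W\<^sub>2 es w * G' w) \<partial>\<Omega>\<^sub>2)"
    using b es i by simp
  then show "(\<integral>w. walk_prod M\<^sub>1 W\<^sub>1 es w * (F w + c * G w) \<partial>\<Omega>\<^sub>1)
      = (\<integral>w. walk_prod M\<^sub>2 W\<^sub>2 es w * (F' w + c * G' w) \<partial>\<Omega>\<^sub>2)"
    by (simp add: algebra_simps)
qed

lemma invariant_const: "invariant (\<lambda>_. c) (\<lambda>_. c)"
proof -
  have "linked (\<lambda>_. 0) (\<lambda>_. 0)" by (auto simp: linked_def)
  then show ?thesis using linked_add_scale[of "\<lambda>_. 0" "\<lambda>_. 0" _ _ c] by (simp add: invariant_def)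
qed

lemma invariant_add:
  "invariant F F' \<Longrightarrow> invariant G G' \<Longrightarrow> invariant (\<lambda>w. F w + G w) (\<lambda>w. F' w + G' w)"
  using linked_add_scale[where c = 1] by (simp add: invariant_def distrib_right)

lemma invariant_mult:
  "invariant F F' \<Longrightarrow> invariant G G' \<Longrightarrow> invariant (\<lambda>w. F w * G w) (\<lambda>w. F' w * G' w)"
  by (simp add: invariant_def mult.assoc)

lemma invariant_diff:
  "invariant F F' \<Longrightarrow> invariant G G' \<Longrightarrow> invariant (\<lambda>w. F w - G w) (\<lambda>w. F' w - G' w)"
  using invariant_add[OF _ invariant_mult[OF invariant_const[of "-1"]]] by simp

lemma invariant_power:
  "invariant F F' \<Longrightarrow> invariant (\<lambda>w. F w ^ n) (\<lambda>w. F' w ^ n)"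
  by (induction n) (auto intro: invariant_const invariant_mult)

lemma invariant_sum:
  "(\<And>k. k < (n::nat) \<Longrightarrow> invariant (F k) (F' k)) \<Longrightarrow> invariant (\<lambda>w. \<Sum>k<n. F k w) (\<lambda>w. \<Sum>k<n. F' k w)"
  by (induction n) (auto intro: invariant_const invariant_add)

text \<open>Multiplication by a walk just puts one more entry on the test list, over which
  \<open>linked\<close> already quantifies. The bound \<open>2 \<le> l\<close> also admits closed
  walks, u = v.\<close>

lemma invariant_walk:
  assumes "u < 2" "v < 2" "2 \<le> l"
  shows "invariant (\<lambda>w. walk M\<^sub>1 W\<^sub>1 l (w u) (w v)) (\<lambda>w. walk M\<^sub>2 W\<^sub>2 l (w u) (w v))"
  unfolding invariant_def
proof (intro allI impI)
  fix G G' assume G: "linked G G'"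
  show "linked (\<lambda>w. walk M\<^sub>1 W\<^sub>1 l (w u) (w v) * G w) (\<lambda>w. walk M\<^sub>2 W\<^sub>2 l (w u) (w v) * G' w)"
    unfolding linked_def
  proof (intro conjI allI impI)
    show "bounded_measurable \<Omega>\<^sub>1 (\<lambda>w. walk M\<^sub>1 W\<^sub>1 l (w u) (w v) * G w)"
      "bounded_measurable \<Omega>\<^sub>2 (\<lambda>w. walk M\<^sub>2 W\<^sub>2 l (w u) (w v) * G' w)"
      using G assms
      by (auto simp: linked_def intro!: bounded_measurable_mult G1.bounded_measurable_walk G2.bounded_measurable_walk)
    fix es assume "simple_walks 2 es"
    then have "simple_walks 2 ((u, v, l) # es)" using assms by (simp add: simple_walks_Cons)
    then show "(\<integral>w. walk_prod M\<^sub>1 W\<^sub>1 es w * (walk M\<^sub>1 W\<^sub>1 l (w u) (w v) * G w) \<partial>\<Omega>\<^sub>1)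
        = (\<integral>w. walk_prod M\<^sub>2 W\<^sub>2 es w * (walk M\<^sub>2 W\<^sub>2 l (w u) (w v) * G' w) \<partial>\<Omega>\<^sub>2)"
      using G by (fastforce simp: linked_def walk_prod_Cons ac_simps)
  qed
qed

end

section \<open>The truncated distance\<close>

text \<open>For \<open>f = W(., x) - W(., y)\<close> and n > 0 this is
  \<open>ip ((T ^^ (n - 1)) ((S ^^ k) f)) f\<close>, with S = 1 - T^2 expanded recursively. Written
  with walks alone, it is visibly determined by walk densities.\<close>

fun walk_form :: "'a measure \<Rightarrow> ('a \<Rightarrow> 'a \<Rightarrow> real) \<Rightarrow> nat \<Rightarrow> nat \<Rightarrow> 'a \<Rightarrow> 'a \<Rightarrow> real" where
  "walk_form M W 0 n x y = walk M W n x x - walk M W n x y - (walk M W n y x - walk M W n y y)"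
| "walk_form M W (Suc k) n x y = walk_form M W k n x y - walk_form M W k (n + 2) x y"

text \<open>The index 3 stands for the factor T^2 between two copies of f: all walks have at least
  four edges, so closed ones are genuine cycles.\<close>

definition trunc_dist :: "'a measure \<Rightarrow> ('a \<Rightarrow> 'a \<Rightarrow> real) \<Rightarrow> nat \<Rightarrow> 'a \<Rightarrow> 'a \<Rightarrow> real" where
  "trunc_dist M W N x y = (\<Sum>k<N. walk_form M W k 3 x y)"

context graphon_space
begin

lemma measurable_walk_form [measurable (raw)]:
  assumes [measurable]: "f \<in> measurable N M" "g \<in> measurable N M"
  shows "(\<lambda>x. walk_form M W k n (f x) (g x)) \<in> borel_measurable N"
  by (induction k arbitrary: n) simp_all

lemma measurable_trunc_dist [measurable (raw)]:
  assumes [measurable]: "f \<in> measurable N M" "g \<in> measurable N M"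
  shows "(\<lambda>x. trunc_dist M W n (f x) (g x)) \<in> borel_measurable N"
  unfolding trunc_dist_def by measurable

lemma walk_form_eq:
  assumes x: "x \<in> space M" and y: "y \<in> space M"
  defines "f \<equiv> \<lambda>z. W z x - W z y"
  shows "walk_form M W k (Suc n) x y = ip ((T ^^ n) ((S ^^ k) f)) f"
proof (induction k arbitrary: n)
  case 0
  note b = bounded_measurable_W'[OF x] bounded_measurable_W'[OF y]
  have Tn: "(T ^^ n) f z = walk M W n z x - walk M W n z y" if "z \<in> space M" for z
    using T_pow_add_scale[OF b that, of n "-1"] by (simp add: walk_def f_def)
  have fz: "f z = W x z - W y z" if "z \<in> space M" for z
    using x y that by (simp add: f_def W_sym)
  have i: "integrable M (\<lambda>z. W u z * walk M W n z v)" if "u \<in> space M" "v \<in> space M" for u v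
    using that bounded_measurable_W
    by (intro integrable_bm bounded_measurable_mult bounded_measurable_walk) auto
  have "ip ((T ^^ n) f) f = (\<integral>z. (W x z * walk M W n z x - W x z * walk M W n z y)
      - (W y z * walk M W n z x - W y z * walk M W n z y) \<partial>M)"
    unfolding ip_def using x y
    by (intro Bochner_Integration.integral_cong) (auto simp: Tn fz algebra_simps)
  also have "\<dots> = walk_form M W 0 (Suc n) x y"
    using x y by (simp add: i walk_Suc)
  finally show ?case by simp
next
  case (Suc k)
  have f: "bounded_measurable M f"
    unfolding f_def using x y by (intro bounded_measurable_diff bounded_measurable_W')
  let ?g = "(S ^^ k) f"
  have g: "bounded_measurable M ?g" "bounded_measurable M (T (T ?g))"
    using f by (auto intro: bm_S_pow bm_T)
  have "(T ^^ n) (S ?g) u = (T ^^ n) ?g u - (T ^^ (n + 2)) ?g u" if "u \<in> space M" for u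
  proof -
    have "(T ^^ (n + 2)) ?g = (T ^^ n) (T (T ?g))" by (simp add: funpow_swap1)
    then show ?thesis using T_pow_add_scale[OF g that, of n "-1"] by (simp only: S_def) simp
  qed
  then have "ip ((T ^^ n) (S ?g)) f = ip (\<lambda>u. (T ^^ n) ?g u - (T ^^ (n + 2)) ?g u) f"
    by (intro ip_cong) auto
  also have "\<dots> = ip ((T ^^ n) ?g) f - ip ((T ^^ (n + 2)) ?g) f"
    using f g by (intro ip_diff bm_T_pow)
  finally show ?case using Suc[of n] Suc[of "n + 2"] by simp
qed

text \<open>The sum telescopes, because T^2 S^k = S^k - S^(k + 1).\<close>

lemma trunc_dist_eq:
  assumes x: "x \<in> space M" and y: "y \<in> space M"
  defines "f \<equiv> \<lambda>z. W z x - W z y"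
  shows "trunc_dist M W n x y = ip f f - ip ((S ^^ n) f) f"
proof (induction n)
  case 0
  then show ?case by (simp add: trunc_dist_def)
next
  case (Suc n)
  have f: "bounded_measurable M f"
    unfolding f_def using x y by (intro bounded_measurable_diff bounded_measurable_W')
  have "ip ((S ^^ Suc n) f) f = ip ((S ^^ n) f) f - ip (T (T ((S ^^ n) f))) f"
    using ip_diff[of "(S ^^ n) f" "T (T ((S ^^ n) f))" f] f by (simp add: S_def bm_S_pow bm_T)
  moreover have "walk_form M W n 3 x y = ip (T (T ((S ^^ n) f))) f"
    using walk_form_eq[OF x y, of n 2] by (simp add: f_def numeral_2_eq_2 numeral_3_eq_3)
  ultimately show ?case using Suc by (simp add: trunc_dist_def)
qed

lemma trunc_dist_double_eq:
  assumes x: "x \<in> space M" and y: "y \<in> space M"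
  defines "f \<equiv> \<lambda>z. W z x - W z y"
  shows "trunc_dist M W (2 * n) x y = ip f f - ip ((S ^^ n) f) ((S ^^ n) f)"
  unfolding trunc_dist_eq[OF x y] f_def
  using x y by (subst ip_S_pow_double) (auto intro!: bounded_measurable_diff bounded_measurable_W')

lemma trunc_dist_bounds:
  assumes x: "x \<in> space M" and y: "y \<in> space M"
  shows "0 \<le> trunc_dist M W (2 * n) x y"
    and "trunc_dist M W (2 * n) x y \<le> (\<integral>z. (W z x - W z y)\<^sup>2 \<partial>M)"
    and "trunc_dist M W (2 * n) x y \<le> 1"
proof -
  define f where "f = (\<lambda>z. W z x - W z y)"
  have f: "bounded_measurable M f"
    unfolding f_def using x y by (intro bounded_measurable_diff bounded_measurable_W')
  have eq: "trunc_dist M W (2 * n) x y = ip f f - ip ((S ^^ n) f) ((S ^^ n) f)"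
    unfolding f_def by (rule trunc_dist_double_eq[OF x y])
  show "0 \<le> trunc_dist M W (2 * n) x y" using ip_S_pow_le[OF f] eq by simp
  have le: "trunc_dist M W (2 * n) x y \<le> ip f f" using eq ip_self_nonneg by simp
  also have "\<dots> = (\<integral>z. (W z x - W z y)\<^sup>2 \<partial>M)" by (simp add: ip_def f_def power2_eq_square)
  finally show "trunc_dist M W (2 * n) x y \<le> (\<integral>z. (W z x - W z y)\<^sup>2 \<partial>M)" .
  have "\<bar>f z\<bar> \<le> 1" if "z \<in> space M" for z
    using W_nonneg[OF that x] W_nonneg[OF that y] W_le_1[OF that x] W_le_1[OF that y] by (simp add: f_def)
  then have "f z * f z \<le> 1" if "z \<in> space M" for z
    using that by (metis abs_square_le_1 power2_eq_square)
  then have "ip f f \<le> 1"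
    unfolding ip_def using f by (intro integral_between_0_1[THEN conjunct2]) auto
  then show "trunc_dist M W (2 * n) x y \<le> 1" using le by simp
qed

text \<open>By symmetry of W, pairing \<open>W(., x)\<close> with \<open>e\<close> gives
  \<open>T e x\<close>, so the coefficient of f along \<open>e\<close> is
  \<open>\<mu> * (e x - e y)\<close>.\<close>

lemma trunc_dist_ge_eigen:
  assumes x: "x \<in> space M" and y: "y \<in> space M"
    and e: "bounded_measurable M e" and eig: "\<And>u. u \<in> space M \<Longrightarrow> T e u = \<mu> * e u"
    and pos: "ip e e > 0"
  shows "(1 - (1 - \<mu>\<^sup>2) ^ (2 * n)) * (\<mu> * (e x - e y))\<^sup>2 / ip e e \<le> trunc_dist M W (2 * n) x y"
proof -
  define f where "f = (\<lambda>z. W z x - W z y)"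
  have f: "bounded_measurable M f"
    unfolding f_def using x y by (intro bounded_measurable_diff bounded_measurable_W')
  have "ip f e = ip (\<lambda>z. W z x) e - ip (\<lambda>z. W z y) e"
    unfolding f_def using x y e by (intro ip_diff bounded_measurable_W')
  also have "ip (\<lambda>z. W z u) e = T e u" if "u \<in> space M" for u
    unfolding ip_def kernel_op_def using that
    by (intro Bochner_Integration.integral_cong) (auto simp: W_sym)
  then have "ip (\<lambda>z. W z x) e - ip (\<lambda>z. W z y) e = \<mu> * (e x - e y)"
    using x y eig by (simp add: right_diff_distrib)
  finally show ?thesis
    using ip_S_pow_eigen[OF f e eig pos, of n] trunc_dist_double_eq[OF x y, of n] by (simp add: f_def)
qed

lemma integral_power_2:
  fixes \<phi> :: "'a \<Rightarrow> 'a \<Rightarrow> real"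
  assumes m: "(\<lambda>p. \<phi> (fst p) (snd p)) \<in> borel_measurable (M \<Otimes>\<^sub>M M)"
    and b: "\<And>x y. x \<in> space M \<Longrightarrow> y \<in> space M \<Longrightarrow> \<bar>\<phi> x y\<bar> \<le> B"
  shows "(\<integral>w. \<phi> (w 0) (w 1) \<partial>(\<Pi>\<^sub>M i\<in>{..<2::nat}. M)) = (\<integral>x. (\<integral>y. \<phi> x y \<partial>M) \<partial>M)"
proof -
  have *: "(\<lambda>x. \<phi> (f x) (g x)) \<in> borel_measurable N"
    if "f \<in> measurable N M" "g \<in> measurable N M" for f g and N :: "'c measure"
    using measurable_compose[OF measurable_Pair[OF that] m] by simp
  have b2: "bounded_measurable (\<Pi>\<^sub>M i\<in>{..<Suc 1}. M) (\<lambda>w. \<phi> (w 0) (w 1))"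
    by (intro bounded_measurableI[of _ _ B] * b measurable_component_singleton)
      (auto simp: space_PiM PiE_def Pi_def)
  have "(\<integral>w. \<phi> (w 0) (w 1) \<partial>(\<Pi>\<^sub>M i\<in>{..<Suc 1}. M))
      = (\<integral>w. (\<integral>z. \<phi> (w 0) z \<partial>M) \<partial>(\<Pi>\<^sub>M i\<in>{..<1::nat}. M))"
    using integral_power_Suc[OF b2] by simp
  also have "\<dots> = (\<integral>x. (\<integral>y. \<phi> x y \<partial>M) \<partial>M)"
  proof -
    have m1: "(\<lambda>x. \<integral>z. \<phi> x z \<partial>M) \<in> borel_measurable M"
      using m by (intro borel_measurable_lebesgue_integral) (simp add: case_prod_beta')
    have "{..<1::nat} = {0}" by auto
    then show ?thesis using PM.product_integral_singleton[OF m1, of 0] by simp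
  qed
  finally show ?thesis by (simp add: numeral_2_eq_2)
qed

end

context equivalent_graphons
begin

lemma invariant_walk_form:
  "2 \<le> n \<Longrightarrow> invariant (\<lambda>w. walk_form M\<^sub>1 W\<^sub>1 k n (w 0) (w 1)) (\<lambda>w. walk_form M\<^sub>2 W\<^sub>2 k n (w 0) (w 1))"
  by (induction k arbitrary: n) (auto intro!: invariant_diff invariant_walk)

lemma trunc_dist_moment_eq:
  "(\<integral>x. (\<integral>y. (1 - trunc_dist M\<^sub>1 W\<^sub>1 (2 * N) x y) ^ n \<partial>M\<^sub>1) \<partial>M\<^sub>1)
     = (\<integral>x. (\<integral>y. (1 - trunc_dist M\<^sub>2 W\<^sub>2 (2 * N) x y) ^ n \<partial>M\<^sub>2) \<partial>M\<^sub>2)"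
proof -
  have bound: "\<bar>(1 - t) ^ n\<bar> \<le> 1" if "0 \<le> t" "t \<le> 1" for t :: real
    using that by (simp add: power_abs power_le_one)
  have "(\<integral>w. (1 - trunc_dist M\<^sub>1 W\<^sub>1 (2 * N) (w 0) (w 1)) ^ n \<partial>\<Omega>\<^sub>1)
      = (\<integral>w. (1 - trunc_dist M\<^sub>2 W\<^sub>2 (2 * N) (w 0) (w 1)) ^ n \<partial>\<Omega>\<^sub>2)"
    unfolding trunc_dist_def
    by (intro invariant_integral_eq invariant_power invariant_diff invariant_const invariant_sum invariant_walk_form) simp
  moreover have "(\<integral>w. (1 - trunc_dist M\<^sub>1 W\<^sub>1 (2 * N) (w 0) (w 1)) ^ n \<partial>\<Omega>\<^sub>1)
      = (\<integral>x. (\<integral>y. (1 - trunc_dist M\<^sub>1 W\<^sub>1 (2 * N) x y) ^ n \<partial>M\<^sub>1) \<partial>M\<^sub>1)"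
    by (intro G1.integral_power_2[where B = 1] bound G1.trunc_dist_bounds) simp_all
  moreover have "(\<integral>w. (1 - trunc_dist M\<^sub>2 W\<^sub>2 (2 * N) (w 0) (w 1)) ^ n \<partial>\<Omega>\<^sub>2)
      = (\<integral>x. (\<integral>y. (1 - trunc_dist M\<^sub>2 W\<^sub>2 (2 * N) x y) ^ n \<partial>M\<^sub>2) \<partial>M\<^sub>2)"
    by (intro G2.integral_power_2[where B = 1] bound G2.trunc_dist_bounds) simp_all
  ultimately show ?thesis by simp
qed

end

section \<open>The lacunary cosine series\<close>

lemma powr_lacunary: "2 powr (- real k * \<alpha>) = (2 powr (- \<alpha>)) ^ k"
  by (simp add: powr_realpow[symmetric] powr_powr mult.commute)

lemma abs_cos_diff_le: "\<bar>cos x - cos y\<bar> \<le> \<bar>x - y\<bar>" for x y :: real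
proof -
  have "\<bar>cos x - cos y\<bar> = 2 * (\<bar>sin ((x + y) / 2)\<bar> * \<bar>sin ((y - x) / 2)\<bar>)"
    by (simp add: cos_diff_cos abs_mult)
  also have "\<dots> \<le> 2 * (1 * \<bar>(y - x) / 2\<bar>)"
    by (intro mult_left_mono mult_mono abs_sin_le_one abs_sin_x_le_abs_x) auto
  finally show ?thesis by simp
qed

context
  fixes \<alpha> q :: real
  assumes \<alpha>: "0 < \<alpha>" "\<alpha> < 1"
  defines "q \<equiv> 2 powr (- \<alpha>)"
begin

text \<open>Both bounds on \<alpha> enter here: q < 1 makes the tails of the series geometric, and 2
  q > 1 lets the Lipschitz constants of its terms grow geometrically, so that the last one
  dominates.\<close>

lemma lacunary_ratio: "0 < q" "q < 1" "1 < 2 * q"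
proof -
  show "0 < q" by (simp add: q_def)
  show "q < 1" using \<alpha> by (simp add: q_def powr_less_one)
  have "(1::real) < 2 powr (1 - \<alpha>)" using \<alpha> by (simp add: gr_one_powr)
  then show "1 < 2 * q" by (simp add: q_def powr_diff powr_minus divide_inverse)
qed

lemma lacunary_cos_eq: "lacunary_cos \<alpha> t = (\<Sum>k. q ^ k * cos (2 * pi * 2 ^ k * t))"
  unfolding lacunary_cos_def powr_lacunary q_def ..

lemma summable_lacunary: "summable (\<lambda>k. q ^ k * cos (2 * pi * 2 ^ k * t))"
  by (rule summable_comparison_test'[of "\<lambda>k. q ^ k" 0])
    (use lacunary_ratio in \<open>auto simp: abs_mult mult_left_le\<close>)

lemma lacunary_cos_even: "lacunary_cos \<alpha> (- t) = lacunary_cos \<alpha> t"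
  by (simp add: lacunary_cos_def)

text \<open>Split the series at the scale K where 2^K reaches 1 / |s - t|. Terms below K are bounded
  by their Lipschitz constants, the others trivially. Both parts are O(q^K), with the two summands
  of \<open>C\<close> as constants, and q^K \<le> |s - t|^\<alpha>.\<close>

lemma lacunary_cos_holder:
  "\<exists>C\<ge>0. \<forall>s t. \<bar>lacunary_cos \<alpha> s - lacunary_cos \<alpha> t\<bar> \<le> C * \<bar>s - t\<bar> powr \<alpha>"
proof -
  note q = lacunary_ratio
  define C where "C = 4 * pi / (2 * q - 1) + 2 / (1 - q)"
  have "C \<ge> 0" using q by (simp add: C_def)
  moreover have "\<bar>lacunary_cos \<alpha> s - lacunary_cos \<alpha> t\<bar> \<le> C * \<bar>s - t\<bar> powr \<alpha>" for s t
  proof (cases "s = t")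
    case False
    define \<tau> where "\<tau> = \<bar>s - t\<bar>"
    have \<tau>: "\<tau> > 0" using False by (simp add: \<tau>_def)
    define P where "P K \<longleftrightarrow> 1 \<le> 2 ^ K * \<tau>" for K :: nat
    obtain K0 :: nat where "1 / \<tau> < 2 ^ K0" using real_arch_pow[of 2 "1 / \<tau>"] by auto
    then have P0: "P K0" using \<tau> by (simp add: P_def field_simps)
    define K where "K = (LEAST K. P K)"
    have K: "1 \<le> 2 ^ K * \<tau>" using LeastI[of P, OF P0] by (simp add: K_def P_def)
    define u where "u k = q ^ k * (cos (2 * pi * 2 ^ k * s) - cos (2 * pi * 2 ^ k * t))" for k
    have su: "u sums (lacunary_cos \<alpha> s - lacunary_cos \<alpha> t)"
      unfolding u_def lacunary_cos_eq right_diff_distrib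
      by (intro sums_diff summable_sums summable_lacunary)
    have b2: "\<bar>u k\<bar> \<le> 2 * q ^ k" for k
    proof -
      have "\<bar>cos (2 * pi * 2 ^ k * s) - cos (2 * pi * 2 ^ k * t)\<bar> \<le> 2"
        using abs_cos_le_one[of "2 * pi * 2 ^ k * s"] abs_cos_le_one[of "2 * pi * 2 ^ k * t"] by linarith
      then show ?thesis using q by (simp add: u_def abs_mult mult.commute)
    qed
    have b1: "\<bar>u k\<bar> \<le> 2 * pi * \<tau> * (2 * q) ^ k" for k
    proof -
      have "\<bar>cos (2 * pi * 2 ^ k * s) - cos (2 * pi * 2 ^ k * t)\<bar> \<le> 2 * pi * 2 ^ k * \<tau>"
        using abs_cos_diff_le[of "2 * pi * 2 ^ k * s" "2 * pi * 2 ^ k * t"]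
        by (simp add: right_diff_distrib[symmetric] abs_mult \<tau>_def)
      then have "q ^ k * \<bar>cos (2 * pi * 2 ^ k * s) - cos (2 * pi * 2 ^ k * t)\<bar> \<le> q ^ k * (2 * pi * 2 ^ k * \<tau>)"
        using q by (intro mult_left_mono) auto
      then show ?thesis using q by (simp add: u_def abs_mult power_mult_distrib ac_simps)
    qed
    have head: "\<bar>\<Sum>k<K. u k\<bar> \<le> 4 * pi / (2 * q - 1) * q ^ K"
    proof (cases K)
      case 0
      then show ?thesis using q by simp
    next
      case (Suc K')
      \<comment> \<open>Minimality of K bounds 2^K |s - t| from above; for K = 0 there is no
        predecessor, but the head is empty.\<close>
      have "\<not> P K'" using not_less_Least[of K' P] Suc by (simp add: K_def)
      then have le2: "2 ^ K * \<tau> \<le> 2" using Suc by (simp add: P_def)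
      have "\<bar>\<Sum>k<K. u k\<bar> \<le> (\<Sum>k<K. 2 * pi * \<tau> * (2 * q) ^ k)"
        by (rule order_trans[OF sum_abs sum_mono[OF b1]])
      also have "\<dots> = 2 * pi * \<tau> * (((2 * q) ^ K - 1) / (2 * q - 1))"
        using q by (simp only: sum_distrib_left[symmetric] geometric_sum[of "2 * q" K])
      also have "\<dots> \<le> 2 * pi * \<tau> * ((2 * q) ^ K / (2 * q - 1))"
        using q \<tau> by (intro mult_left_mono divide_right_mono) auto
      also have "\<dots> = (2 * pi / (2 * q - 1) * q ^ K) * (2 ^ K * \<tau>)"
        by (simp add: power_mult_distrib ac_simps)
      also have "\<dots> \<le> (2 * pi / (2 * q - 1) * q ^ K) * 2"
        using q le2 by (intro mult_left_mono) auto
      finally show ?thesis by simp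
    qed
    have tail: "\<bar>(\<Sum>k. u (k + K))\<bar> \<le> 2 / (1 - q) * q ^ K"
    proof -
      have g: "(\<lambda>k. 2 * q ^ (k + K)) sums (2 / (1 - q) * q ^ K)"
      proof -
        have "(\<lambda>k. 2 * q ^ K * q ^ k) sums (2 * q ^ K * (1 / (1 - q)))"
          using q by (intro sums_mult geometric_sums) simp
        then show ?thesis by (simp add: power_add ac_simps)
      qed
      have s: "summable (\<lambda>k. \<bar>u (k + K)\<bar>)"
        using b2 by (intro summable_comparison_test'[OF sums_summable[OF g], of 0]) auto
      have "\<bar>(\<Sum>k. u (k + K))\<bar> \<le> (\<Sum>k. \<bar>u (k + K)\<bar>)" by (rule summable_rabs[OF s])
      also have "\<dots> \<le> (\<Sum>k. 2 * q ^ (k + K))" by (intro suminf_le b2 s sums_summable[OF g])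
      finally show ?thesis using sums_unique[OF g] by simp
    qed
    have "lacunary_cos \<alpha> s - lacunary_cos \<alpha> t = (\<Sum>k. u (k + K)) + (\<Sum>k<K. u k)"
      using suminf_split_initial_segment[OF sums_summable[OF su], of K] sums_unique[OF su] by simp
    then have "\<bar>lacunary_cos \<alpha> s - lacunary_cos \<alpha> t\<bar> \<le> C * q ^ K"
      using head tail by (simp add: C_def distrib_right)
    also have "q ^ K \<le> \<tau> powr \<alpha>"
    proof -
      have "q ^ K = 1 / (2 ^ K) powr \<alpha>"
      proof -
        have "(2 ^ K) powr \<alpha> = 2 powr (real K * \<alpha>)" by (simp add: powr_realpow[symmetric] powr_powr)
        then have "q ^ K * (2 ^ K) powr \<alpha> = 1"
          by (simp add: q_def powr_lacunary[symmetric] powr_add[symmetric])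
        then show ?thesis by (simp add: field_simps)
      qed
      also have "\<dots> \<le> \<tau> powr \<alpha>"
      proof -
        have "1 \<le> (2 ^ K * \<tau>) powr \<alpha>" using K \<alpha> by (simp add: ge_one_powr_ge_zero)
        then show ?thesis using \<tau> by (simp add: powr_mult field_simps)
      qed
      finally show ?thesis .
    qed
    finally show ?thesis using \<open>C \<ge> 0\<close> by (simp add: \<tau>_def mult_left_mono)
  qed simp
  ultimately show ?thesis by blast
qed

lemma lacunary_cos_measurable [measurable]: "lacunary_cos \<alpha> \<in> borel_measurable borel"
  unfolding lacunary_cos_def[abs_def] by measurable

lemma lacunary_cos_bound: "\<bar>lacunary_cos \<alpha> t\<bar> \<le> 1 / (1 - q)"
proof -
  note q = lacunary_ratio
  have s: "summable (\<lambda>k. \<bar>q ^ k * cos (2 * pi * 2 ^ k * t)\<bar>)"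
    by (rule summable_comparison_test'[of "\<lambda>k. q ^ k" 0])
      (use q in \<open>auto simp: abs_mult mult_left_le\<close>)
  have "\<bar>lacunary_cos \<alpha> t\<bar> \<le> (\<Sum>k. \<bar>q ^ k * cos (2 * pi * 2 ^ k * t)\<bar>)"
    unfolding lacunary_cos_eq by (rule summable_rabs[OF s])
  also have "\<dots> \<le> (\<Sum>k. q ^ k)"
    using q by (intro suminf_le s) (auto simp: abs_mult mult_left_le intro: summable_geometric)
  also have "\<dots> = 1 / (1 - q)" using q by (simp add: suminf_geometric)
  finally show ?thesis .
qed

end

section \<open>Integrals over the unit interval\<close>

abbreviation unit_interval :: "real measure" where "unit_interval \<equiv> leb {0..1}"

lemma space_leb [simp]: "space (leb D) = D"
  by (simp add: leb_def space_restrict_space)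

lemma measurable_leb: "f \<in> borel_measurable borel \<Longrightarrow> f \<in> borel_measurable (leb D)"
  unfolding leb_def by (intro measurable_restrict_space1) simp

lemma integral_leb:
  fixes f :: "'a::euclidean_space \<Rightarrow> real"
  assumes "D \<in> sets borel"
  shows "(\<integral>x. f x \<partial>leb D) = (\<integral>x. indicator D x * f x \<partial>lborel)"
  using assms by (simp add: leb_def integral_restrict_space)

lemma prob_space_unit_interval: "prob_space unit_interval"
  by (rule prob_spaceI) (simp add: leb_def space_restrict_space emeasure_restrict_space)

interpretation unit_interval: prob_space unit_interval
  by (rule prob_space_unit_interval)

lemma measure_unit_interval [simp]: "measure unit_interval {0..1} = 1"
  using unit_interval.prob_space by simp

lemma integral_unit_interval_FTC:
  fixes f F :: "real \<Rightarrow> real"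
  assumes "\<And>x. (F has_real_derivative f x) (at x)" "\<And>x. isCont f x"
  shows "(\<integral>x. f x \<partial>unit_interval) = F 1 - F 0"
  using integral_FTC_Icc_real[of 0 1 F f] assms by (simp add: integral_leb mult.commute)

lemma integral_cos_int_period:
  assumes "n \<in> \<int>" "n \<noteq> 0"
  shows "(\<integral>z. cos (2 * pi * n * z + c) \<partial>unit_interval) = 0"
proof -
  have "(\<integral>z. cos (2 * pi * n * z + c) \<partial>unit_interval)
      = sin (2 * pi * n * 1 + c) / (2 * pi * n) - sin (2 * pi * n * 0 + c) / (2 * pi * n)"
    by (rule integral_unit_interval_FTC)
      (use assms in \<open>auto intro!: derivative_eq_intros continuous_intros\<close>)
  also have "sin (2 * pi * n * 1 + c) = sin c"
  proof -
    have "sin (c + 2 * pi * n) = sin c"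
      using assms(1) by (simp add: sin_add sin_integer_2pi cos_integer_2pi)
    then show ?thesis by (simp add: add.commute)
  qed
  finally show ?thesis by simp
qed

lemma cos_bounded_measurable [intro]: "bounded_measurable unit_interval (\<lambda>z. cos (b * z + c))"
  by (rule bounded_measurableI[of _ _ 1]) (auto intro: measurable_leb)

text \<open>The product is half a sum of cosines with the integer frequencies
  \<open>- 2^m - 2^k\<close> and \<open>2^k - 2^m\<close>. Nonzero frequencies integrate to 0, and
  only the second can vanish, exactly for m = k.\<close>

lemma integral_cos_mult_cos:
  fixes x \<theta> :: real
  shows "(\<integral>z. cos (2 * pi * 2 ^ m * (x - z)) * cos (2 * pi * 2 ^ k * z - \<theta>) \<partial>unit_interval)
    = (if m = k then cos (2 * pi * 2 ^ k * x - \<theta>) / 2 else 0)"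
proof -
  define A where "A = 2 * pi * 2 ^ m * x"
  define n1 n2 where "n1 = - ((2::real) ^ m) - 2 ^ k" and "n2 = 2 ^ k - (2::real) ^ m"
  have nz: "n1 \<in> \<int>" "n2 \<in> \<int>" "n1 \<noteq> 0" "n2 = 0 \<longleftrightarrow> m = k"
  proof -
    show "n1 \<in> \<int>" "n2 \<in> \<int>" by (auto simp: n1_def n2_def)
    have "0 < (2::real) ^ m + 2 ^ k" by (simp add: add_pos_pos)
    then show "n1 \<noteq> 0" by (simp add: n1_def)
    show "n2 = 0 \<longleftrightarrow> m = k" by (auto simp: n2_def)
  qed
  have "cos (2 * pi * 2 ^ m * (x - z)) * cos (2 * pi * 2 ^ k * z - \<theta>)
      = cos (2 * pi * n1 * z + (A + \<theta>)) / 2 + cos (2 * pi * n2 * z + (A - \<theta>)) / 2" for z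
    unfolding cos_times_cos by (simp add: n1_def n2_def A_def algebra_simps add_divide_distrib)
  then have "(\<integral>z. cos (2 * pi * 2 ^ m * (x - z)) * cos (2 * pi * 2 ^ k * z - \<theta>) \<partial>unit_interval)
      = (\<integral>z. cos (2 * pi * n1 * z + (A + \<theta>)) \<partial>unit_interval) / 2
        + (\<integral>z. cos (2 * pi * n2 * z + (A - \<theta>)) \<partial>unit_interval) / 2"
    by (simp add: unit_interval.bounded_measurable_integrable cos_bounded_measurable)
  also have "(\<integral>z. cos (2 * pi * n1 * z + (A + \<theta>)) \<partial>unit_interval) = 0"
    using nz by (intro integral_cos_int_period) auto
  also have "(\<integral>z. cos (2 * pi * n2 * z + (A - \<theta>)) \<partial>unit_interval)
      = (if m = k then cos (2 * pi * 2 ^ k * x - \<theta>) else 0)"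
  proof (cases "m = k")
    case True
    then show ?thesis by (simp add: n2_def A_def)
  next
    case False
    then show ?thesis using nz integral_cos_int_period[of n2 "A - \<theta>"] by simp
  qed
  finally show ?thesis by (cases "m = k") auto
qed

lemma integral_cos_lacunary:
  fixes k :: nat
  shows "(\<integral>z. cos (2 * pi * 2 ^ k * z - \<theta>) \<partial>unit_interval) = 0"
  using integral_cos_int_period[of "2 ^ k" "-\<theta>"] by simp

lemma integral_cos_square:
  "(\<integral>z. cos (2 * pi * 2 ^ k * z - \<theta>) * cos (2 * pi * 2 ^ k * z - \<theta>) \<partial>unit_interval) = 1 / 2"
proof -
  \<comment> \<open>The point x = \<theta> / (2 pi 2^k) turns the first factor of the preceding
    integral into a copy of the second.\<close>
  have "2 * pi * 2 ^ k * (\<theta> / (2 * pi * 2 ^ k) - z) = - (2 * pi * 2 ^ k * z - \<theta>)" for z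
    by (simp add: right_diff_distrib)
  then have "cos (2 * pi * 2 ^ k * (\<theta> / (2 * pi * 2 ^ k) - z)) = cos (2 * pi * 2 ^ k * z - \<theta>)" for z
    by (simp only: cos_minus)
  then show ?thesis using integral_cos_mult_cos[of k "\<theta> / (2 * pi * 2 ^ k)" k \<theta>] by simp
qed

text \<open>Domination by q^m allows termwise integration, and only the term m = k survives. The
  phase \<theta> stays free so that it can later be adapted to the pair x, y.\<close>

lemma integral_lacunary_cos_mult_cos:
  assumes \<alpha>: "0 < \<alpha>" "\<alpha> < 1"
  shows "(\<integral>z. lacunary_cos \<alpha> (x - z) * cos (2 * pi * 2 ^ k * z - \<theta>) \<partial>unit_interval)
    = 2 powr (- real k * \<alpha>) / 2 * cos (2 * pi * 2 ^ k * x - \<theta>)"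
proof -
  define q :: real where "q = 2 powr (- \<alpha>)"
  note q = lacunary_ratio[OF \<alpha>, folded q_def]
  define f where "f m z = q ^ m * (cos (2 * pi * 2 ^ m * (x - z)) * cos (2 * pi * 2 ^ k * z - \<theta>))" for m z
  have fb: "norm (f m z) \<le> q ^ m" for m z
  proof -
    have "\<bar>cos (2 * pi * 2 ^ m * (x - z))\<bar> * \<bar>cos (2 * pi * 2 ^ k * z - \<theta>)\<bar> \<le> 1"
      by (intro mult_le_one) auto
    then show ?thesis using q by (simp add: f_def abs_mult mult_left_le)
  qed
  have bm: "bounded_measurable unit_interval (f m)" for m
    by (rule bounded_measurableI[of _ _ "q ^ m"])
      (use fb in \<open>auto simp: f_def[abs_def] intro!: measurable_leb\<close>)
  have fi: "(\<integral>z. f m z \<partial>unit_interval) = (if m = k then q ^ k * cos (2 * pi * 2 ^ k * x - \<theta>) / 2 else 0)" for m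
    by (simp add: f_def integral_cos_mult_cos)
  have sg: "summable (\<lambda>m. q ^ m)" using q by (intro summable_geometric) auto
  have "(\<lambda>m. \<integral>z. f m z \<partial>unit_interval) sums (\<integral>z. (\<Sum>m. f m z) \<partial>unit_interval)"
  proof (rule sums_integral)
    show "integrable unit_interval (f m)" for m by (rule unit_interval.bounded_measurable_integrable[OF bm])
    show "AE z in unit_interval. summable (\<lambda>m. norm (f m z))"
      using fb by (intro AE_I2 summable_comparison_test'[OF sg, of 0]) auto
    have "(\<integral>z. norm (f m z) \<partial>unit_interval) \<le> q ^ m" for m
      using fb by (intro unit_interval.integral_le_const integrable_norm unit_interval.bounded_measurable_integrable[OF bm]) auto
    then show "summable (\<lambda>m. \<integral>z. norm (f m z) \<partial>unit_interval)"
      by (intro summable_comparison_test'[OF sg, of 0]) auto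
  qed
  moreover have "(\<lambda>m. \<integral>z. f m z \<partial>unit_interval) sums (q ^ k * cos (2 * pi * 2 ^ k * x - \<theta>) / 2)"
    unfolding fi using sums_single[of k "\<lambda>_. q ^ k * cos (2 * pi * 2 ^ k * x - \<theta>) / 2"] by simp
  moreover have "(\<Sum>m. f m z) = lacunary_cos \<alpha> (x - z) * cos (2 * pi * 2 ^ k * z - \<theta>)" for z
  proof -
    have "(\<Sum>m. f m z) = (\<Sum>m. (q ^ m * cos (2 * pi * 2 ^ m * (x - z))) * cos (2 * pi * 2 ^ k * z - \<theta>))"
      by (simp add: f_def mult.assoc)
    also have "\<dots> = lacunary_cos \<alpha> (x - z) * cos (2 * pi * 2 ^ k * z - \<theta>)"
      using suminf_mult2[OF summable_lacunary[OF \<alpha>], of "x - z" "cos (2 * pi * 2 ^ k * z - \<theta>)"]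
      by (simp add: lacunary_cos_eq[OF \<alpha>] q_def)
    finally show ?thesis .
  qed
  ultimately have "(\<integral>z. lacunary_cos \<alpha> (x - z) * cos (2 * pi * 2 ^ k * z - \<theta>) \<partial>unit_interval)
      = q ^ k * cos (2 * pi * 2 ^ k * x - \<theta>) / 2"
    using sums_unique2 by (simp only:)
  then show ?thesis unfolding powr_lacunary q_def[symmetric] by simp
qed

section \<open>Integrals over the unit cube\<close>

lemma unit_cube_eq: "unit_cube = cbox (0 :: real ^ 'd) 1"
  by (auto simp: unit_cube_def mem_box_cart)

lemma sets_unit_cube [simp]: "unit_cube \<in> sets borel"
  by (simp add: unit_cube_eq)

lemma indicator_unit_cube:
  "indicator unit_cube z = (\<Prod>i\<in>UNIV. indicator {0..1} (z $ i) :: real)" for z :: "real ^ 'd"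
proof (cases "z \<in> unit_cube")
  case False
  then obtain i where "z $ i \<notin> {0..1}" by (auto simp: unit_cube_def)
  then have "(\<Prod>i\<in>UNIV. indicator {0..1} (z $ i) :: real) = 0"
    by (intro prod_zero bexI[of _ i]) auto
  then show ?thesis using False by simp
qed (auto simp: unit_cube_def)

lemma integral_unit_cube_prod:
  fixes g :: "'d::finite \<Rightarrow> real \<Rightarrow> real"
  assumes g: "\<And>i. bounded_measurable unit_interval (g i)"
  shows "(\<integral>z. (\<Prod>i\<in>UNIV. g i (z $ i)) \<partial>leb (unit_cube :: (real ^ 'd) set))
    = (\<Prod>i\<in>UNIV. (\<integral>t. g i t \<partial>unit_interval))"
proof -
  interpret product_sigma_finite "\<lambda>_::real ^ 'd. lborel :: real measure" ..
  define G where "G i t = indicator {0..1} t * g i t" for i t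
  have int: "integrable lborel (G i)" for i
    using unit_interval.bounded_measurable_integrable[OF g[of i]]
    by (simp add: G_def[abs_def] leb_def integrable_restrict_space)
  then have [measurable]: "G i \<in> borel_measurable borel" for i by auto
  \<comment> \<open>\<open>lborel\<close> is a product measure over \<open>Basis\<close>, while the
    factors are indexed by coordinates; this translates between the two.\<close>
  have reidx: "(\<Prod>b\<in>Basis. h (axis_index b) b) = (\<Prod>i\<in>UNIV. h i (axis i 1))"
    for h :: "'d \<Rightarrow> real ^ 'd \<Rightarrow> real"
  proof -
    have inj: "inj (\<lambda>i::'d. axis i (1::real))" by (auto simp: inj_on_def axis_eq_axis)
    have basis: "(Basis :: (real ^ 'd) set) = range (\<lambda>i. axis i 1)" by (auto simp: Basis_vec_def)
    show ?thesis unfolding basis by (subst prod.reindex[OF inj]) simp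
  qed
  have "(\<integral>z. (\<Prod>i\<in>UNIV. g i (z $ i)) \<partial>leb (unit_cube :: (real ^ 'd) set))
      = (\<integral>z. (\<Prod>i\<in>UNIV. G i (z $ i)) \<partial>(lborel :: (real ^ 'd) measure))"
    by (simp add: integral_leb indicator_unit_cube G_def prod.distrib)
  also have "\<dots> = (\<integral>z. (\<Prod>b\<in>Basis. G (axis_index b) (z \<bullet> b)) \<partial>(lborel :: (real ^ 'd) measure))"
    using reidx[of "\<lambda>i b. G i (z \<bullet> b)" for z] by (simp add: cart_eq_inner_axis)
  also have "\<dots> = (\<integral>w. (\<Prod>b\<in>(Basis :: (real ^ 'd) set). G (axis_index b) (w b)) \<partial>(\<Pi>\<^sub>M b\<in>Basis. lborel))"
    unfolding lborel_eq[where 'a = "real ^ 'd"] by (subst integral_distr) (auto intro!: Bochner_Integration.integral_cong prod.cong)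
  also have "\<dots> = (\<Prod>b\<in>(Basis :: (real ^ 'd) set). integral\<^sup>L lborel (G (axis_index b)))"
    using int by (intro product_integral_prod) auto
  also have "\<dots> = (\<Prod>i\<in>UNIV. integral\<^sup>L lborel (G i))"
    using reidx[of "\<lambda>i b. integral\<^sup>L lborel (G i)"] by simp
  finally show ?thesis by (simp add: integral_leb G_def[abs_def])
qed

lemma integral_unit_cube_coord:
  fixes g :: "real \<Rightarrow> real"
  assumes "bounded_measurable unit_interval g"
  shows "(\<integral>z. g (z $ i) \<partial>leb (unit_cube :: (real ^ 'd) set)) = (\<integral>t. g t \<partial>unit_interval)"
proof -
  have "(\<integral>z. (\<Prod>j\<in>UNIV. (if j = i then g (z $ j) else 1)) \<partial>leb (unit_cube :: (real ^ 'd) set))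
      = (\<Prod>j\<in>UNIV. (\<integral>t. (if j = i then g t else 1) \<partial>unit_interval))"
  proof (rule integral_unit_cube_prod[of "\<lambda>j t. if j = i then g t else 1"])
    show "bounded_measurable unit_interval (\<lambda>t. if j = i then g t else 1)" for j
      using assms by (cases "j = i") auto
  qed
  also have "\<dots> = (\<Prod>j\<in>UNIV. (if j = i then (\<integral>t. g t \<partial>unit_interval) else 1))"
    by (intro prod.cong) auto
  also have "\<dots> = (\<integral>t. g t \<partial>unit_interval)" by simp
  finally show ?thesis by (simp add: if_distrib)
qed

lemma integral_unit_cube_coord2:
  fixes g h :: "real \<Rightarrow> real"
  assumes "bounded_measurable unit_interval g" "bounded_measurable unit_interval h" "i \<noteq> k"
  shows "(\<integral>z. g (z $ i) * h (z $ k) \<partial>leb (unit_cube :: (real ^ 'd) set))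
    = (\<integral>t. g t \<partial>unit_interval) * (\<integral>t. h t \<partial>unit_interval)"
proof -
  let ?f = "\<lambda>j t. (if j = i then g t else 1) * (if j = k then h t else 1)"
  have "(\<integral>z. (\<Prod>j\<in>UNIV. ?f j (z $ j)) \<partial>leb (unit_cube :: (real ^ 'd) set))
      = (\<Prod>j\<in>UNIV. (\<integral>t. ?f j t \<partial>unit_interval))"
  proof (rule integral_unit_cube_prod[of ?f])
    show "bounded_measurable unit_interval (?f j)" for j
      using assms by (cases "j = i"; cases "j = k") auto
  qed
  also have "\<dots> = (\<Prod>j\<in>UNIV. (if j = i then (\<integral>t. g t \<partial>unit_interval) else 1)
      * (if j = k then (\<integral>t. h t \<partial>unit_interval) else 1))"
    using assms(3) by (intro prod.cong) auto
  finally show ?thesis by (simp add: prod.distrib prod.delta)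
qed

lemma prob_space_unit_cube: "prob_space (leb (unit_cube :: (real ^ 'd) set))"
proof (rule prob_spaceI)
  have "measure lborel (cbox (0 :: real ^ 'd) 1) = 1"
    by (subst content_cbox_cart) (auto simp: interval_ne_empty_cart)
  then have "emeasure lborel (cbox (0 :: real ^ 'd) 1) = 1"
    using emeasure_lborel_cbox_finite[of "0 :: real ^ 'd" 1] by (simp add: emeasure_eq_ennreal_measure)
  then show "emeasure (leb (unit_cube :: (real ^ 'd) set)) (space (leb unit_cube)) = 1"
    by (simp add: leb_def space_restrict_space emeasure_restrict_space unit_cube_eq)
qed

section \<open>Points near the integers\<close>

text \<open>Each doubling halves the distance while the integer m found at k = 0 is kept: 2^(K + 1)
  (t - m) is already within half a period of 0, and there a positive cosine forces it within a
  quarter.\<close>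

lemma cos_pos_near_int:
  fixes t :: real
  assumes "\<And>k. k \<le> K \<Longrightarrow> 0 < cos (2 * pi * 2 ^ k * t)"
  shows "\<exists>m::int. \<bar>t - m\<bar> < 1 / 4 / 2 ^ K"
proof -
  have near: "\<bar>s\<bar> < 1 / 4" if "0 < cos (2 * pi * s)" "\<bar>s\<bar> \<le> 1 / 2" for s :: real
  proof (rule ccontr)
    assume n: "\<not> \<bar>s\<bar> < 1 / 4"
    have "cos (2 * pi * \<bar>s\<bar>) \<le> cos (pi / 2)"
      using n that(2) by (intro cos_monotone_0_pi_le) auto
    moreover have "cos (2 * pi * \<bar>s\<bar>) = cos (2 * pi * s)" by (simp add: abs_if)
    ultimately show False using that(1) by simp
  qed
  have per: "cos (2 * pi * (s - of_int n)) = cos (2 * pi * s)" for s :: real and n :: int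
    by (simp add: right_diff_distrib cos_diff cos_int_2pin sin_int_2pin)
  show ?thesis
    using assms
  proof (induction K)
    case 0
    have "\<bar>t - round t\<bar> \<le> 1 / 2" using of_int_round_abs_le[of t] by (simp add: abs_minus_commute)
    then show ?case using near[of "t - round t"] 0[of 0] per[of t "round t"] by auto
  next
    case (Suc K)
    then obtain m :: int where m: "\<bar>t - m\<bar> < 1 / 4 / 2 ^ K" by force
    define s where "s = 2 ^ Suc K * (t - m)"
    have "\<bar>s\<bar> = 2 * (2 ^ K * \<bar>t - m\<bar>)" by (simp add: s_def abs_mult)
    moreover have "2 ^ K * \<bar>t - m\<bar> < 1 / 4" using m by (simp add: field_simps)
    ultimately have "\<bar>s\<bar> \<le> 1 / 2" by simp
    moreover have "cos (2 * pi * s) = cos (2 * pi * 2 ^ Suc K * t)"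
      using per[of "2 ^ Suc K * t" "2 ^ Suc K * m"] by (simp add: s_def algebra_simps)
    ultimately have "\<bar>s\<bar> < 1 / 4" using near[of s] Suc.prems[of "Suc K"] by simp
    moreover have "\<bar>s\<bar> = 2 ^ Suc K * \<bar>t - m\<bar>" by (simp add: s_def abs_mult)
    ultimately have "\<bar>t - m\<bar> < 1 / 4 / 2 ^ Suc K" by (simp add: field_simps)
    then show ?case by blast
  qed
qed

text \<open>As |x - t| \<le> 1 and \<rho> \<le> 1, only m = -1, 0, 1 occur, each contributing an
  interval of length 2 \<rho>.\<close>

lemma integral_near_int_le:
  fixes x \<rho> :: real
  assumes x: "0 \<le> x" "x \<le> 1" and \<rho>: "0 < \<rho>" "\<rho> \<le> 1"
  shows "(\<integral>t. indicator {t. \<exists>m::int. \<bar>x - t - m\<bar> < \<rho>} t \<partial>unit_interval) \<le> 6 * \<rho>"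
proof -
  let ?A = "{t. \<exists>m::int. \<bar>x - t - m\<bar> < \<rho>}"
  have "open ?A"
  proof -
    have "?A = (\<Union>m::int. {t. \<bar>x - t - m\<bar> < \<rho>})" by auto
    moreover have "open {t. \<bar>x - t - m\<bar> < \<rho>}" for m :: int
      by (intro open_Collect_less continuous_intros)
    ultimately show ?thesis by auto
  qed
  then have [measurable]: "?A \<in> sets borel" by simp
  have int: "integrable lborel (\<lambda>t. indicator {x - m - \<rho>..x - m + \<rho>} t :: real)" for m
    by (intro integrable_real_indicator) (auto simp: emeasure_lborel_Icc_eq)
  have "(\<integral>t. (indicator ?A t :: real) \<partial>unit_interval) = (\<integral>t. indicator ({0..1} \<inter> ?A) t \<partial>lborel)"
    by (subst integral_leb, simp) (intro Bochner_Integration.integral_cong refl, simp only: indicator_inter_arith)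
  also have "\<dots> \<le> (\<integral>t. (\<Sum>m\<in>{-1, 0, 1::real}. indicator {x - m - \<rho>..x - m + \<rho>} t) \<partial>lborel)"
  proof (rule integral_mono)
    show "integrable lborel (\<lambda>t. indicator ({0..1} \<inter> ?A) t :: real)"
      by (rule Bochner_Integration.integrable_bound[of _ "indicator {0..1::real} :: real \<Rightarrow> real"])
        (auto simp: indicator_def)
    show "integrable lborel (\<lambda>t. (\<Sum>m\<in>{-1, 0, 1::real}. indicator {x - m - \<rho>..x - m + \<rho>} t) :: real)"
      using int by (intro Bochner_Integration.integrable_sum)
    fix t :: real
    show "indicator ({0..1} \<inter> ?A) t \<le> (\<Sum>m\<in>{-1, 0, 1::real}. indicator {x - m - \<rho>..x - m + \<rho>} t :: real)"
    proof (cases "t \<in> {0..1} \<inter> ?A")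
      case True
      then obtain m :: int where m: "\<bar>x - t - m\<bar> < \<rho>" and t: "0 \<le> t" "t \<le> 1" by auto
      then have "\<bar>real_of_int m\<bar> < 2" using x \<rho> by linarith
      then have "\<bar>m\<bar> < 2" by linarith
      then have "m \<in> {-1, 0, 1}" by auto
      then have mm: "real_of_int m \<in> {-1, 0, 1::real}" by auto
      have "1 = (indicator {x - m - \<rho>..x - m + \<rho>} t :: real)" using m by (auto simp: indicator_def)
      also have "\<dots> \<le> (\<Sum>m\<in>{-1, 0, 1::real}. indicator {x - m - \<rho>..x - m + \<rho>} t)"
        using mm by (intro member_le_sum) auto
      finally show ?thesis using True by simp
    qed (auto intro!: sum_nonneg)
  qed
  also have "\<dots> = (\<Sum>m\<in>{-1, 0, 1::real}. (\<integral>t. indicator {x - m - \<rho>..x - m + \<rho>} t \<partial>lborel))"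
    using int by (intro Bochner_Integration.integral_sum)
  also have "\<dots> = 6 * \<rho>" using \<rho> by simp
  finally show ?thesis .
qed

lemma measurable_unit_cube_coord:
  "(\<lambda>z. z $ i) \<in> measurable (leb (unit_cube :: (real ^ 'd) set)) unit_interval"
  unfolding leb_def
  by (intro measurable_restrict_space2 measurable_restrict_space1)
    (auto simp: space_restrict_space unit_cube_def)

lemma bm_unit_cube_coord:
  "bounded_measurable unit_interval g \<Longrightarrow>
    bounded_measurable (leb (unit_cube :: (real ^ 'd) set)) (\<lambda>z. g (z $ i))"
  by (rule bounded_measurable_compose[OF _ measurable_unit_cube_coord])

lemma bm_lacunary_cos:
  assumes "0 < \<alpha>" "\<alpha> < 1"
  shows "bounded_measurable unit_interval (\<lambda>t. lacunary_cos \<alpha> (x - t))"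
  by (rule bounded_measurableI[OF measurable_leb lacunary_cos_bound[OF assms]])
    (use lacunary_cos_measurable[OF assms] in measurable)

section \<open>Comparison of the moments\<close>

text \<open>Parameters for the final contradiction: \<delta> = 2^(-\<gamma> K) with \<gamma>
  strictly between \<alpha> / \<beta> and d. The lower bound on \<gamma> makes n \<delta>^(2
  \<beta>) small, the upper bound makes the cube term negligible against \<delta>.\<close>

lemma exponential_gap:
  fixes \<alpha> \<beta> a C :: real and d :: nat
  assumes "0 < \<alpha>" "0 < \<beta>" "0 < a" "\<alpha> / \<beta> < real d"
  shows "\<exists>K n :: nat. \<exists>\<delta>. 0 < \<delta> \<and> \<delta> \<le> 1 / 2 \<and> real n * (C\<^sup>2 * \<delta> powr (2 * \<beta>)) \<le> 1 / 2 \<and>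
    (6 * (1 / 4 / 2 ^ K)) ^ d + exp (- (real n * (a * 2 powr (- real K * \<alpha>) / 2)\<^sup>2)) < \<delta> / 2"
proof -
  define L where "L = ln (2::real)"
  have L: "0 < L" "L < 1" using ln_2_less_1 by (auto simp: L_def)
  obtain \<gamma> where \<gamma>: "\<alpha> / \<beta> < \<gamma>" "\<gamma> < real d" using dense[OF assms(4)] by blast
  have \<gamma>0: "0 < \<gamma>" using \<gamma>(1) assms(1,2) by (meson divide_pos_pos less_trans)
  have ab: "\<alpha> < \<gamma> * \<beta>" using \<gamma>(1) assms(2) by (simp add: field_simps)
  \<comment> \<open>Decay rates in K: c1 for the main part of n \<delta>^(2 \<beta>), c2 for the
    part due to rounding n up, c3 and c4 for the cube term and the exponential term, both divided by
    \<delta>.\<close>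
  define c1 c2 c3 c4 where "c1 = 2 * (\<gamma> * \<beta> - \<alpha>) * L" and "c2 = 2 * \<gamma> * \<beta> * L"
    and "c3 = (real d - \<gamma>) * L" and "c4 = real d - \<gamma> * L"
  have c: "c1 > 0" "c2 > 0" "c3 > 0" "c4 > 0"
  proof -
    show "c1 > 0" "c2 > 0" "c3 > 0"
      using ab L \<gamma> \<gamma>0 assms by (auto simp: c1_def c2_def c3_def)
    have "\<gamma> * L < \<gamma> * 1" using \<gamma>0 L by (intro mult_strict_left_mono) auto
    then show "c4 > 0" using \<gamma>(2) by (simp add: c4_def)
  qed
  \<comment> \<open>The coefficient in
    \<open>K * d / r = A * K * exp (2 * \<alpha> * L * K)\<close>, where r is the squared eigenvalue
    at scale K.\<close>
  define A where "A = 4 * real d / a\<^sup>2"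
  have e0: "((\<lambda>K::real. exp (- c * K)) \<longlongrightarrow> 0) at_top" "((\<lambda>K::real. K * exp (- c * K)) \<longlongrightarrow> 0) at_top"
    if "c > 0" for c :: real
    using that by real_asymp+
  have lim1: "((\<lambda>K. C\<^sup>2 * A * (K * exp (- c1 * K)) + C\<^sup>2 * exp (- c2 * K)) \<longlongrightarrow> 0) at_top"
    using tendsto_add[OF tendsto_mult[OF tendsto_const[of "C\<^sup>2 * A"] e0(2)[OF c(1)]]
        tendsto_mult[OF tendsto_const[of "C\<^sup>2"] e0(1)[OF c(2)]]] by simp
  have lim2: "((\<lambda>K. (3 / 2) ^ d * exp (- c3 * K) + exp (- c4 * K)) \<longlongrightarrow> 0) at_top"
    using tendsto_add[OF tendsto_mult[OF tendsto_const[of "(3 / 2) ^ d"] e0(1)[OF c(3)]] e0(1)[OF c(4)]]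
    by simp
  have lim3: "((\<lambda>K. exp (- (\<gamma> * L) * K)) \<longlongrightarrow> 0) at_top"
    using \<gamma>0 L by (intro e0(1)) simp
  have "eventually (\<lambda>K. C\<^sup>2 * A * (K * exp (- c1 * K)) + C\<^sup>2 * exp (- c2 * K) < 1 / 2 \<and>
      (3 / 2) ^ d * exp (- c3 * K) + exp (- c4 * K) < 1 / 2 \<and> exp (- (\<gamma> * L) * K) < 1 / 2) at_top"
    using order_tendstoD(2)[OF lim1, of "1 / 2"] order_tendstoD(2)[OF lim2, of "1 / 2"]
      order_tendstoD(2)[OF lim3, of "1 / 2"] by (auto intro: eventually_conj)
  then have "eventually (\<lambda>K::nat. C\<^sup>2 * A * (real K * exp (- c1 * real K)) + C\<^sup>2 * exp (- c2 * real K) < 1 / 2 \<and>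
      (3 / 2) ^ d * exp (- c3 * real K) + exp (- c4 * real K) < 1 / 2 \<and> exp (- (\<gamma> * L) * real K) < 1 / 2) at_top"
    by (rule eventually_compose_filterlim[OF _ filterlim_real_sequentially])
  then obtain K :: nat where K:
    "C\<^sup>2 * A * (real K * exp (- c1 * real K)) + C\<^sup>2 * exp (- c2 * real K) < 1 / 2"
    "(3 / 2) ^ d * exp (- c3 * real K) + exp (- c4 * real K) < 1 / 2"
    "exp (- (\<gamma> * L) * real K) < 1 / 2"
    using eventually_happens by force
  define \<delta> where "\<delta> = exp (- (\<gamma> * L) * real K)"
  define r where "r = (a * 2 powr (- real K * \<alpha>) / 2)\<^sup>2"
  have r: "r = a\<^sup>2 / 4 * exp (- 2 * \<alpha> * L * real K)"
    by (simp add: r_def powr_def L_def power_mult_distrib power_divide exp_double[symmetric] ac_simps)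
  have r0: "r > 0" unfolding r using assms by (intro mult_pos_pos) auto
  \<comment> \<open>The factor K d pushes exp (- n r) below exp (- K d), which is much smaller than
    \<delta> because \<gamma> ln 2 < d. The price is only a factor of order K, which the exponential
    decay in the first condition absorbs.\<close>
  define n where "n = nat \<lceil>real K * real d / r\<rceil>"
  have n1: "real K * real d / r \<le> real n" by (simp add: n_def real_nat_ceiling_ge)
  have n2: "real n \<le> real K * real d / r + 1" 
    using r0 by (simp add: n_def)
  have Kdr: "real K * real d / r = A * real K * exp (2 * \<alpha> * L * real K)"
    using assms by (simp add: r A_def exp_minus field_simps)
  have \<delta>2: "\<delta> powr (2 * \<beta>) = exp (- c2 * real K)"
    by (simp add: \<delta>_def powr_def c2_def ac_simps)
  have "real n * (C\<^sup>2 * \<delta> powr (2 * \<beta>)) \<le> (real K * real d / r + 1) * (C\<^sup>2 * \<delta> powr (2 * \<beta>))"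
    using n2 by (intro mult_right_mono) auto
  also have "\<dots> = C\<^sup>2 * A * (real K * (exp (2 * \<alpha> * L * real K) * exp (- c2 * real K))) + C\<^sup>2 * exp (- c2 * real K)"
    unfolding Kdr \<delta>2 by (simp add: algebra_simps)
  also have "exp (2 * \<alpha> * L * real K) * exp (- c2 * real K) = exp (- c1 * real K)"
    by (simp add: exp_add[symmetric] c1_def c2_def algebra_simps)
  finally have 1: "real n * (C\<^sup>2 * \<delta> powr (2 * \<beta>)) \<le> 1 / 2" using K(1) by simp
  have "exp (- (real n * r)) \<le> exp (- (real K * real d))"
    using n1 r0 by (simp add: pos_divide_le_eq)
  also have "\<dots> = \<delta> * exp (- c4 * real K)"
    by (simp add: \<delta>_def c4_def exp_add[symmetric] algebra_simps)
  finally have 2: "exp (- (real n * r)) \<le> \<delta> * exp (- c4 * real K)" .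
  have "(6 * (1 / 4 / 2 ^ K)) ^ d = (3 / 2) ^ d * exp (- (real d * L * real K))"
  proof -
    have "(2::real) ^ K = exp (L * real K)"
      using powr_realpow[of "2::real" K] by (simp add: L_def powr_def mult.commute)
    then have "6 * (1 / 4 / 2 ^ K) = 3 / 2 * exp (- (L * real K))" by (simp add: exp_minus field_simps)
    then have "(6 * (1 / 4 / 2 ^ K)) ^ d = (3 / 2) ^ d * exp (- (L * real K)) ^ d"
      by (simp only: power_mult_distrib)
    also have "exp (- (L * real K)) ^ d = exp (- (real d * L * real K))"
      using exp_of_nat_mult[of d "- (L * real K)"] by (simp add: mult.assoc)
    finally show ?thesis .
  qed
  also have "exp (- (real d * L * real K)) = \<delta> * exp (- c3 * real K)"
    by (simp add: \<delta>_def c3_def exp_add[symmetric] algebra_simps)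
  finally have "(6 * (1 / 4 / 2 ^ K)) ^ d + exp (- (real n * r))
      \<le> \<delta> * ((3 / 2) ^ d * exp (- c3 * real K) + exp (- c4 * real K))"
    using 2 by (simp add: distrib_left mult.left_commute)
  also have "\<dots> < \<delta> * (1 / 2)" using K(2) by (intro mult_strict_left_mono) (auto simp: \<delta>_def)
  finally show ?thesis
    using 1 K(3) by (intro exI[of _ K] exI[of _ n] exI[of _ \<delta>]) (simp add: r_def \<delta>_def)
qed

text \<open>Each x has an interval of length \<delta> of points y within \<delta> of it. There the
  truncated distance is at most C^2 \<delta>^(2 \<beta>), and Bernoulli's inequality keeps the
  integrand above 1/2. The bound is uniform in N.\<close>

lemma holder_moment_lower_bound:
  fixes U :: "real \<Rightarrow> real \<Rightarrow> real"
  assumes U: "graphon unit_interval U"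
    and C: "\<And>p p'. p \<in> {0..1} \<times> {0..1} \<Longrightarrow> p' \<in> {0..1} \<times> {0..1} \<Longrightarrow>
      \<bar>(case p of (x, y) \<Rightarrow> U x y) - (case p' of (x, y) \<Rightarrow> U x y)\<bar> \<le> C * norm (p - p') powr \<beta>"
    and \<beta>: "0 < \<beta>" and \<delta>: "0 < \<delta>" "\<delta> \<le> 1 / 2"
    and n: "real n * (C\<^sup>2 * \<delta> powr (2 * \<beta>)) \<le> 1 / 2"
  shows "\<delta> / 2 \<le> (\<integral>x. (\<integral>y. (1 - trunc_dist unit_interval U (2 * N) x y) ^ n \<partial>unit_interval) \<partial>unit_interval)"
proof -
  interpret G: graphon_space unit_interval U by (rule graphon_imp_graphon_space[OF U])
  let ?T = "trunc_dist unit_interval U (2 * N)"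
  have Tb: "0 \<le> ?T x y" "?T x y \<le> 1" if "x \<in> {0..1}" "y \<in> {0..1}" for x y
    using G.trunc_dist_bounds that by auto
  have T_le: "?T x y \<le> C\<^sup>2 * \<delta> powr (2 * \<beta>)"
    if xy: "x \<in> {0..1}" "y \<in> {0..1}" "\<bar>x - y\<bar> \<le> \<delta>" for x y
  proof -
    have "(U z x - U z y)\<^sup>2 \<le> C\<^sup>2 * \<delta> powr (2 * \<beta>)" if z: "z \<in> {0..1}" for z
    proof -
      have "\<bar>U z x - U z y\<bar> \<le> C * \<bar>x - y\<bar> powr \<beta>"
        using C[of "(z, x)" "(z, y)"] xy z by (simp add: norm_Pair)
      \<comment> \<open>The absolute value appears because a Hoelder constant carries no sign
        condition.\<close>
      also have "\<dots> \<le> \<bar>C\<bar> * \<delta> powr \<beta>"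
        using xy(3) \<beta> by (intro mult_mono powr_mono2) auto
      finally have "\<bar>U z x - U z y\<bar> \<le> \<bar>\<bar>C\<bar> * \<delta> powr \<beta>\<bar>" by simp
      then have "(U z x - U z y)\<^sup>2 \<le> (\<bar>C\<bar> * \<delta> powr \<beta>)\<^sup>2"
        by (simp only: abs_le_square_iff)
      also have "\<dots> = C\<^sup>2 * \<delta> powr (2 * \<beta>)"
      proof -
        have "(\<delta> powr \<beta>)\<^sup>2 = \<delta> powr (2 * \<beta>)"
          by (simp only: power2_eq_square powr_add[symmetric] mult_2)
        then show ?thesis by (simp only: power_mult_distrib power2_abs)
      qed
      finally show ?thesis .
    qed
    moreover have "bounded_measurable unit_interval (\<lambda>z. (U z x - U z y)\<^sup>2)"
      unfolding power2_eq_square using xy G.bounded_measurable_W'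
      by (intro bounded_measurable_mult bounded_measurable_diff) auto
    ultimately have "(\<integral>z. (U z x - U z y)\<^sup>2 \<partial>unit_interval) \<le> C\<^sup>2 * \<delta> powr (2 * \<beta>)"
      by (intro unit_interval.integral_le_const G.integrable_bm) auto
    then show ?thesis using G.trunc_dist_bounds(2)[of x y N] xy by simp
  qed
  have bmT: "bounded_measurable unit_interval (\<lambda>y. (1 - ?T x y) ^ n)" if x: "x \<in> {0..1}" for x
  proof (rule bounded_measurableI[of _ _ 1])
    have "x \<in> space unit_interval" using x by simp
    then show "(\<lambda>y. (1 - ?T x y) ^ n) \<in> borel_measurable unit_interval" by measurable
    show "\<bar>(1 - ?T x y) ^ n\<bar> \<le> 1" if "y \<in> space unit_interval" for y
      using Tb[of x y] x that by (simp add: power_abs power_le_one)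
  qed
  have inner: "\<delta> / 2 \<le> (\<integral>y. (1 - ?T x y) ^ n \<partial>unit_interval)" if x: "x \<in> {0..1}" for x
  proof -
    \<comment> \<open>The interval lies to the right or to the left of x, so none of it is lost at
      the ends of [0, 1]; this uses \<delta> \<le> 1/2.\<close>
    obtain b where b: "0 \<le> b" "b + \<delta> \<le> 1" "b \<le> x" "x \<le> b + \<delta>"
    proof (cases "x \<le> 1 / 2")
      case True then show ?thesis using x \<delta> by (intro that[of x]) auto
    next
      case False then show ?thesis using x \<delta> by (intro that[of "x - \<delta>"]) auto
    qed
    have sub: "{0..1} \<inter> {b..b + \<delta>} = {b..b + \<delta>}" using b by auto
    have "\<delta> / 2 = (\<integral>y. 1 / 2 * indicator ({0..1} \<inter> {b..b + \<delta>}) y \<partial>lborel)"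
      unfolding sub using \<delta> by simp
    also have "\<dots> = (\<integral>y. 1 / 2 * indicator {b..b + \<delta>} y \<partial>unit_interval)"
      by (subst integral_leb, simp)
        (intro Bochner_Integration.integral_cong refl, simp only: indicator_inter_arith ac_simps)
    also have "\<dots> \<le> (\<integral>y. (1 - ?T x y) ^ n \<partial>unit_interval)"
    proof (rule integral_mono)
      show "integrable unit_interval (\<lambda>y. 1 / 2 * indicator {b..b + \<delta>} y :: real)"
        by (intro G.integrable_bm bounded_measurableI[of _ _ 1] measurable_leb) (auto simp: indicator_def)
      show "integrable unit_interval (\<lambda>y. (1 - ?T x y) ^ n)" by (intro G.integrable_bm bmT x)
      fix y assume "y \<in> space unit_interval"
      then have y: "y \<in> {0..1}" by simp
      show "1 / 2 * indicator {b..b + \<delta>} y \<le> (1 - ?T x y) ^ n"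
      proof (cases "y \<in> {b..b + \<delta>}")
        case True
        then have "\<bar>x - y\<bar> \<le> \<delta>" using b by auto
        then have "real n * ?T x y \<le> 1 / 2"
          using mult_left_mono[OF T_le[OF x y], of "real n"] n by simp
        then show ?thesis
          using Bernoulli_inequality[of "- ?T x y" n] Tb[OF x y] True by simp
      qed (use Tb[OF x y] in auto)
    qed
    finally show ?thesis .
  qed
  show ?thesis
  proof (rule unit_interval.integral_ge_const)
    have "(\<lambda>x. \<integral>y. (1 - ?T x y) ^ n \<partial>unit_interval) \<in> borel_measurable unit_interval"
      by measurable
    moreover have "\<bar>\<integral>y. (1 - ?T x y) ^ n \<partial>unit_interval\<bar> \<le> 1" if "x \<in> {0..1}" for x
      using that Tb[of x] bmT[of x]
        unit_interval.integral_between_0_1[OF bounded_measurable_measurable[OF bmT[of x]]]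
      by (simp add: power_le_one)
    ultimately show "integrable unit_interval (\<lambda>x. \<integral>y. (1 - ?T x y) ^ n \<partial>unit_interval)"
      by (intro G.integrable_bm bounded_measurableI[of _ _ 1]) auto
    show "AE x in unit_interval. \<delta> / 2 \<le> (\<integral>y. (1 - ?T x y) ^ n \<partial>unit_interval)"
      using inner by (intro AE_I2) simp
  qed
qed

section \<open>The lacunary graphon: regularity, eigenfunctions and moments\<close>

context
  fixes \<alpha> a :: real and W :: "real ^ 'd \<Rightarrow> real ^ 'd \<Rightarrow> real"
  assumes \<alpha>: "0 < \<alpha>" "\<alpha> < 1" and a: "a > 0"
    and W_eq: "\<And>x y. x \<in> unit_cube \<Longrightarrow> y \<in> unit_cube \<Longrightarrow>
           W x y = 1 / 2 + a * (\<Sum>i\<in>UNIV. lacunary_cos \<alpha> (x $ i - y $ i))"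
    and W_bounds: "\<And>x y. x \<in> unit_cube \<Longrightarrow> y \<in> unit_cube \<Longrightarrow> 0 \<le> W x y \<and> W x y \<le> 1"
begin

lemma graphon_lacunary: "graphon (leb unit_cube) W"
  unfolding graphon_def
proof (intro conjI ballI)
  show "prob_space (leb (unit_cube :: (real ^ 'd) set))" by (rule prob_space_unit_cube)
  let ?M = "leb (unit_cube :: (real ^ 'd) set)"
  have c: "(\<lambda>z. z $ i) \<in> borel_measurable ?M" for i by (intro measurable_leb) measurable
  have [measurable]: "lacunary_cos \<alpha> \<in> borel_measurable borel" by (rule lacunary_cos_measurable[OF \<alpha>])
  have [measurable]: "(\<lambda>p. fst p $ i) \<in> borel_measurable (?M \<Otimes>\<^sub>M ?M)"
    "(\<lambda>p. snd p $ i) \<in> borel_measurable (?M \<Otimes>\<^sub>M ?M)" for i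
    by (rule measurable_compose[OF measurable_fst c] measurable_compose[OF measurable_snd c])+
  have "(\<lambda>p. 1 / 2 + a * (\<Sum>i\<in>UNIV. lacunary_cos \<alpha> (fst p $ i - snd p $ i))) \<in> borel_measurable (?M \<Otimes>\<^sub>M ?M)"
    by measurable
  \<comment> \<open>W is prescribed on the cube only, hence the transfer from the explicit formula
    by congruence on the space.\<close>
  then show "(\<lambda>(x, y). W x y) \<in> borel_measurable (?M \<Otimes>\<^sub>M ?M)"
    by (rule measurable_cong[THEN iffD1, rotated]) (auto simp: space_pair_measure W_eq)
  fix x y :: "real ^ 'd" assume "x \<in> space ?M" "y \<in> space ?M"
  then have xy: "x \<in> unit_cube" "y \<in> unit_cube" by auto
  show "W x y = W y x"
    using lacunary_cos_even[of \<alpha> "y $ i - x $ i" for i] xy \<alpha> by (simp add: W_eq)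
  show "0 \<le> W x y" "W x y \<le> 1" using W_bounds xy by auto
qed

text \<open>Each difference x_i - y_i moves by at most twice the norm, whence the factor
  \<open>2 powr \<alpha>\<close>; summing over coordinates gives \<open>CARD('d)\<close>.\<close>

lemma holder_lacunary: "holder_graphon_on \<alpha> unit_cube W"
proof -
  obtain C where C: "C \<ge> 0" "\<And>s t. \<bar>lacunary_cos \<alpha> s - lacunary_cos \<alpha> t\<bar> \<le> C * \<bar>s - t\<bar> powr \<alpha>"
    using lacunary_cos_holder[OF \<alpha>] by blast
  have "\<bar>W x y - W x' y'\<bar> \<le> (a * real CARD('d) * C * 2 powr \<alpha>) * norm ((x, y) - (x', y')) powr \<alpha>"
    if "x \<in> unit_cube" "y \<in> unit_cube" "x' \<in> unit_cube" "y' \<in> unit_cube" for x y x' y'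
  proof -
    let ?N = "norm ((x, y) - (x', y'))"
    have t: "\<bar>lacunary_cos \<alpha> (x $ i - y $ i) - lacunary_cos \<alpha> (x' $ i - y' $ i)\<bar> \<le> C * (2 * ?N) powr \<alpha>" for i
    proof -
      have "\<bar>x $ i - x' $ i\<bar> \<le> ?N"
        using component_le_norm_cart[of "x - x'" i] norm_fst_le[of "x - x'" "y - y'"] by simp
      moreover have "\<bar>y $ i - y' $ i\<bar> \<le> ?N"
        using component_le_norm_cart[of "y - y'" i] norm_snd_le[of "y - y'" "x - x'"] by simp
      ultimately have "\<bar>(x $ i - y $ i) - (x' $ i - y' $ i)\<bar> \<le> 2 * ?N" by linarith
      then have "C * \<bar>(x $ i - y $ i) - (x' $ i - y' $ i)\<bar> powr \<alpha> \<le> C * (2 * ?N) powr \<alpha>"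
        using C(1) \<alpha> by (intro mult_left_mono powr_mono2) auto
      then show ?thesis using C(2) order_trans by blast
    qed
    have "W x y - W x' y' = a * (\<Sum>i\<in>UNIV. lacunary_cos \<alpha> (x $ i - y $ i) - lacunary_cos \<alpha> (x' $ i - y' $ i))"
      using that by (simp add: W_eq sum_subtractf right_diff_distrib)
    then have "\<bar>W x y - W x' y'\<bar>
        = a * \<bar>\<Sum>i\<in>UNIV. lacunary_cos \<alpha> (x $ i - y $ i) - lacunary_cos \<alpha> (x' $ i - y' $ i)\<bar>"
      using a by (simp add: abs_mult)
    also have "\<dots> \<le> a * (\<Sum>i\<in>(UNIV :: 'd set). C * (2 * ?N) powr \<alpha>)"
      using a by (intro mult_left_mono order_trans[OF sum_abs sum_mono[OF t]]) auto
    also have "\<dots> = (a * real CARD('d) * C * 2 powr \<alpha>) * ?N powr \<alpha>" by (simp add: powr_mult)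
    finally show ?thesis .
  qed
  then show ?thesis unfolding holder_graphon_on_def holder_on_def by fastforce
qed

interpretation GW: graphon_space "leb (unit_cube :: (real ^ 'd) set)" W
  by (rule graphon_imp_graphon_space[OF graphon_lacunary])

definition eigenval :: "nat \<Rightarrow> real" where
  "eigenval k = a * 2 powr (- real k * \<alpha>) / 2"

text \<open>The cosine has mean zero, which removes the constant 1/2 and, by the product formula,
  every summand with j different from i. The remaining one is the one-dimensional
  convolution.\<close>

lemma eigenfunction:
  assumes u: "u \<in> unit_cube"
  shows "GW.T (\<lambda>z. cos (2 * pi * 2 ^ k * (z $ i) - \<theta>)) u = eigenval k * cos (2 * pi * 2 ^ k * (u $ i) - \<theta>)"
proof -
  let ?M = "leb (unit_cube :: (real ^ 'd) set)"
  define c where "c t = cos (2 * pi * 2 ^ k * t - \<theta>)" for t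
  have c: "bounded_measurable unit_interval c"
    unfolding c_def using cos_bounded_measurable[of "2 * pi * 2 ^ k" "- \<theta>"] by simp
  have h: "bounded_measurable unit_interval (\<lambda>t. lacunary_cos \<alpha> (s - t))" for s
    by (rule bm_lacunary_cos[OF \<alpha>])
  have coord: "(\<integral>z. lacunary_cos \<alpha> (u $ j - z $ j) * c (z $ i) \<partial>?M)
      = (if j = i then 2 powr (- real k * \<alpha>) / 2 * c (u $ i) else 0)" for j
  proof (cases "j = i")
    case True
    then show ?thesis
      using integral_unit_cube_coord[OF bounded_measurable_mult[OF h c], of "u $ i" i]
        integral_lacunary_cos_mult_cos[OF \<alpha>, of "u $ i" k \<theta>] by (simp add: c_def)
  next
    case False
    then show ?thesis
      using integral_unit_cube_coord2[OF h[of "u $ j"] c False] integral_cos_lacunary[of k \<theta>]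
      by (simp add: c_def)
  qed
  have int: "integrable ?M (\<lambda>z. lacunary_cos \<alpha> (u $ j - z $ j) * c (z $ i))" "integrable ?M (\<lambda>z. c (z $ i))" for j
    using bm_unit_cube_coord[OF h] bm_unit_cube_coord[OF c]
    by (auto intro!: GW.integrable_bm bounded_measurable_mult)
  have "GW.T (\<lambda>z. c (z $ i)) u
      = (\<integral>z. 1 / 2 * c (z $ i) + a * (\<Sum>j\<in>UNIV. lacunary_cos \<alpha> (u $ j - z $ j) * c (z $ i)) \<partial>?M)"
    unfolding kernel_op_def using u
    by (intro Bochner_Integration.integral_cong) (simp_all add: W_eq sum_distrib_left[symmetric] sum_distrib_right[symmetric] algebra_simps)
  also have "\<dots> = 1 / 2 * (\<integral>z. c (z $ i) \<partial>?M) + a * (\<Sum>j\<in>UNIV. (\<integral>z. lacunary_cos \<alpha> (u $ j - z $ j) * c (z $ i) \<partial>?M))"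
    using int by simp
  also have "(\<integral>z. c (z $ i) \<partial>?M) = 0"
    using integral_unit_cube_coord[OF c, of i] integral_cos_lacunary[of k \<theta>] by (simp add: c_def)
  also have "(\<Sum>j\<in>UNIV. (\<integral>z. lacunary_cos \<alpha> (u $ j - z $ j) * c (z $ i) \<partial>?M)) = 2 powr (- real k * \<alpha>) / 2 * c (u $ i)"
    unfolding coord by simp
  finally show ?thesis by (simp add: eigenval_def c_def)
qed

lemma bm_eigenfunction:
  "bounded_measurable (leb (unit_cube :: (real ^ 'd) set)) (\<lambda>z. cos (2 * pi * 2 ^ k * (z $ i) - \<theta>))"
  using bm_unit_cube_coord[OF cos_bounded_measurable[of "2 * pi * 2 ^ k" "- \<theta>"]] by simp

lemma ip_eigenfunction:
  "GW.ip (\<lambda>z. cos (2 * pi * 2 ^ k * (z $ i) - \<theta>)) (\<lambda>z. cos (2 * pi * 2 ^ k * (z $ i) - \<theta>)) = 1 / 2"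
proof -
  have "bounded_measurable unit_interval (\<lambda>t. cos (2 * pi * 2 ^ k * t - \<theta>))"
    using cos_bounded_measurable[of "2 * pi * 2 ^ k" "- \<theta>"] by simp
  from integral_unit_cube_coord[OF bounded_measurable_mult[OF this this], of i]
  show ?thesis by (simp add: GW.ip_def integral_cos_square)
qed

lemma eigenval_pos: "0 < eigenval k"
  using a by (simp add: eigenval_def)

lemma eigenval_le_1: "(eigenval k)\<^sup>2 \<le> 1"
proof (rule GW.eigenvalue_le_1[OF bm_eigenfunction])
  \<comment> \<open>\<open>undefined\<close> is an arbitrary coordinate: every coordinate and every
    phase give an eigenfunction for \<open>eigenval k\<close>.\<close>
  show "0 < GW.ip (\<lambda>z. cos (2 * pi * 2 ^ k * (z $ undefined) - 0)) (\<lambda>z. cos (2 * pi * 2 ^ k * (z $ undefined) - 0))"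
    unfolding ip_eigenfunction by simp
qed (simp only: space_leb eigenfunction)

lemma eigenval_antimono: "k \<le> K \<Longrightarrow> eigenval K \<le> eigenval k"
  using a \<alpha> by (simp add: eigenval_def)

text \<open>The eigenfunction has squared norm 1/2, the truncation factor is at least 1/2, and a
  good phase makes the squared difference of its values at least 2; this even gives twice the
  bound.\<close>

lemma trunc_dist_ge_eigenval:
  assumes x: "x \<in> unit_cube" and y: "y \<in> unit_cube"
    and cos: "cos (2 * pi * 2 ^ k * (x $ i - y $ i)) \<le> 0"
    and N: "(1 - (eigenval k)\<^sup>2) ^ (2 * N) \<le> 1 / 2"
  shows "(eigenval k)\<^sup>2 \<le> trunc_dist (leb unit_cube) W (2 * N) x y"
proof -
  define X Y where "X = 2 * pi * 2 ^ k * (x $ i)" and "Y = 2 * pi * 2 ^ k * (y $ i)"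
  \<comment> \<open>This phase puts the midpoint of X and Y at a zero of the cosine. The two values
    are then opposite, and their squared difference 2 (1 - cos (X - Y)) is the largest over all
    phases.\<close>
  define \<theta> where "\<theta> = (X + Y) / 2 - pi / 2"
  define s where "s = sin ((X - Y) / 2)"
  have "X - \<theta> = (X - Y) / 2 + pi / 2" "Y - \<theta> = pi / 2 - (X - Y) / 2"
    by (simp_all add: \<theta>_def field_simps)
  then have "cos (X - \<theta>) = - s" "cos (Y - \<theta>) = s"
    by (simp_all add: s_def cos_add cos_diff)
  then have "(cos (X - \<theta>) - cos (Y - \<theta>))\<^sup>2 = 4 * s\<^sup>2" by (simp add: power2_eq_square)
  also have "\<dots> = 2 * (1 - cos (X - Y))"
  proof -
    have "2 * ((X - Y) / 2) = X - Y" by simp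
    then have "cos (X - Y) = 1 - 2 * s\<^sup>2"
      using cos_double_sin[of "(X - Y) / 2"] by (simp only: s_def)
    then show ?thesis by simp
  qed
  also have "\<dots> \<ge> 2" using cos by (simp add: X_def Y_def right_diff_distrib)
  finally have sq: "2 \<le> (cos (X - \<theta>) - cos (Y - \<theta>))\<^sup>2" .
  have "(eigenval k)\<^sup>2 \<le> (1 / 2 * ((eigenval k)\<^sup>2 * 2)) / (1 / 2)" by simp
  also have "\<dots> \<le> ((1 - (1 - (eigenval k)\<^sup>2) ^ (2 * N)) * ((eigenval k)\<^sup>2 * (cos (X - \<theta>) - cos (Y - \<theta>))\<^sup>2)) / (1 / 2)"
    using N sq by (intro divide_right_mono mult_mono) auto
  also have "\<dots> \<le> trunc_dist (leb unit_cube) W (2 * N) x y"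
    using GW.trunc_dist_ge_eigen[OF _ _ bm_eigenfunction, of x y k i \<theta> "eigenval k" N]
      eigenfunction[of _ k i \<theta>] ip_eigenfunction[of k i \<theta>] x y
    by (simp add: X_def Y_def power_mult_distrib)
  finally show ?thesis .
qed

text \<open>Either the truncated distance reaches the squared eigenvalue at scale K, or every
  coordinate of x - y is near an integer. The coordinates are independent, so the second event has a
  d-th power as its bound: here the dimension enters.\<close>

lemma lacunary_moment_upper_bound:
  assumes N: "(1 - (eigenval K)\<^sup>2) ^ (2 * N) \<le> 1 / 2"
  shows "(\<integral>x. (\<integral>y. (1 - trunc_dist (leb unit_cube) W (2 * N) x y) ^ n \<partial>leb unit_cube) \<partial>leb unit_cube)
    \<le> (6 * (1 / 4 / 2 ^ K)) ^ CARD('d) + (1 - (eigenval K)\<^sup>2) ^ n"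
proof -
  let ?M = "leb (unit_cube :: (real ^ 'd) set)"
  let ?T = "trunc_dist ?M W (2 * N)"
  define \<rho> :: real where "\<rho> = 1 / 4 / 2 ^ K"
  have "(1::real) \<le> 4 * 2 ^ K" using one_le_power[of "2::real" K] by linarith
  then have \<rho>: "0 < \<rho>" "\<rho> \<le> 1" by (simp_all add: \<rho>_def field_simps)
  define A where "A s = {t. \<exists>m::int. \<bar>s - t - m\<bar> < \<rho>}" for s
  have "open (A s)" for s
  proof -
    have "A s = (\<Union>m::int. {t. \<bar>s - t - m\<bar> < \<rho>})" by (auto simp: A_def)
    moreover have "open {t. \<bar>s - t - m\<bar> < \<rho>}" for m :: int
      by (intro open_Collect_less continuous_intros)
    ultimately show ?thesis by auto
  qed
  then have Am [measurable]: "A s \<in> sets borel" for s by simp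
  have bmA: "bounded_measurable unit_interval (indicator (A s) :: real \<Rightarrow> real)" for s
    by (intro bounded_measurableI[of _ _ 1] measurable_leb) (auto simp: indicator_def)
  let ?r = "(eigenval K)\<^sup>2"
  have r: "0 \<le> ?r" "?r \<le> 1" using eigenval_le_1 by auto
  have Tb: "0 \<le> ?T x y" "?T x y \<le> 1" if "x \<in> unit_cube" "y \<in> unit_cube" for x y
    using GW.trunc_dist_bounds that by auto
  have pw: "(1 - ?T x y) ^ n \<le> (\<Prod>i\<in>UNIV. indicator (A (x $ i)) (y $ i)) + (1 - ?r) ^ n"
    if x: "x \<in> unit_cube" and y: "y \<in> unit_cube" for x y
  proof (cases "?r \<le> ?T x y")
    case True
    then have "(1 - ?T x y) ^ n \<le> (1 - ?r) ^ n" using Tb[OF x y] by (intro power_mono) auto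
    moreover have "0 \<le> (\<Prod>i\<in>UNIV. indicator (A (x $ i)) (y $ i) :: real)" by (intro prod_nonneg) auto
    ultimately show ?thesis by simp
  next
    case False
    have "y $ i \<in> A (x $ i)" for i
    proof -
      have "0 < cos (2 * pi * 2 ^ k * (x $ i - y $ i))" if "k \<le> K" for k
      proof (rule ccontr)
        assume n: "\<not> 0 < cos (2 * pi * 2 ^ k * (x $ i - y $ i))"
        \<comment> \<open>Coarser scales have larger eigenvalues, so the assumption on N at scale K
          carries over to every k \<le> K.\<close>
        have rk: "?r \<le> (eigenval k)\<^sup>2"
          using eigenval_antimono[OF that] eigenval_pos[of K] by (intro power_mono) auto
        then have "(1 - (eigenval k)\<^sup>2) ^ (2 * N) \<le> (1 - ?r) ^ (2 * N)"
          using eigenval_le_1[of k] by (intro power_mono) auto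
        then have "(eigenval k)\<^sup>2 \<le> ?T x y"
          using N n by (intro trunc_dist_ge_eigenval[OF x y, of k i]) auto
        then show False using rk False by simp
      qed
      from cos_pos_near_int[OF this] show ?thesis by (simp add: A_def \<rho>_def)
    qed
    moreover have "(1 - ?T x y) ^ n \<le> 1" using Tb[OF x y] by (simp add: power_le_one)
    ultimately show ?thesis using r by (simp add: add_increasing2)
  qed
  have bmT: "bounded_measurable ?M (\<lambda>y. (1 - ?T x y) ^ n)" if x: "x \<in> unit_cube" for x
  proof (rule bounded_measurableI[of _ _ 1])
    have "x \<in> space ?M" using x by simp
    then show "(\<lambda>y. (1 - ?T x y) ^ n) \<in> borel_measurable ?M" by measurable
    show "\<bar>(1 - ?T x y) ^ n\<bar> \<le> 1" if "y \<in> space ?M" for y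
      using Tb[of x y] x that by (simp add: power_abs power_le_one)
  qed
  have inner: "(\<integral>y. (1 - ?T x y) ^ n \<partial>?M) \<le> (6 * \<rho>) ^ CARD('d) + (1 - ?r) ^ n"
    if x: "x \<in> unit_cube" for x
  proof -
    let ?P = "\<lambda>y. (\<Prod>i\<in>UNIV. indicator (A (x $ i)) (y $ i)) :: real"
    have bmP: "bounded_measurable ?M ?P"
      by (intro bounded_measurable_prod bm_unit_cube_coord bmA) auto
    have "(\<integral>y. (1 - ?T x y) ^ n \<partial>?M) \<le> (\<integral>y. ?P y + (1 - ?r) ^ n \<partial>?M)"
      by (rule integral_mono)
        (use pw x bmP in \<open>auto intro!: GW.integrable_bm bmT bounded_measurable_add\<close>)
    also have "\<dots> = (\<integral>y. ?P y \<partial>?M) + (1 - ?r) ^ n"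
      using GW.integrable_bm[OF bmP] GW.prob_space by simp
    also have "(\<integral>y. ?P y \<partial>?M) = (\<Prod>i\<in>UNIV. (\<integral>t. indicator (A (x $ i)) t \<partial>unit_interval))"
      using bmA by (rule integral_unit_cube_prod)
    also have "\<dots> \<le> (\<Prod>i\<in>(UNIV :: 'd set). 6 * \<rho>)"
      using integral_near_int_le[OF _ _ \<rho>] x
      by (intro prod_mono conjI integral_nonneg_AE AE_I2) (auto simp: A_def unit_cube_def)
    finally show ?thesis by simp
  qed
  have "(\<integral>x. (\<integral>y. (1 - ?T x y) ^ n \<partial>?M) \<partial>?M) \<le> (6 * \<rho>) ^ CARD('d) + (1 - ?r) ^ n"
  proof (rule GW.integral_le_const)
    have "(\<lambda>x. \<integral>y. (1 - ?T x y) ^ n \<partial>?M) \<in> borel_measurable ?M"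
      by measurable
    moreover have "\<bar>\<integral>y. (1 - ?T x y) ^ n \<partial>?M\<bar> \<le> 1" if "x \<in> unit_cube" for x
      using that Tb[of x] bmT[of x]
        GW.integral_between_0_1[OF bounded_measurable_measurable[OF bmT[of x]]]
      by (simp add: power_le_one)
    ultimately show "integrable ?M (\<lambda>x. \<integral>y. (1 - ?T x y) ^ n \<partial>?M)"
      by (intro GW.integrable_bm bounded_measurableI[of _ _ 1]) auto
    show "AE x in ?M. (\<integral>y. (1 - ?T x y) ^ n \<partial>?M) \<le> (6 * \<rho>) ^ CARD('d) + (1 - ?r) ^ n"
      using inner by (intro AE_I2) simp
  qed
  then show ?thesis by (simp add: \<rho>_def)
qed

text \<open>The order of choices matters: C comes from the Hoelder condition, then K, n and
  \<delta>, and N last. N may depend on all of them, since neither moment bound deteriorates as N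
  grows.\<close>

lemma not_equivalent_holder:
  assumes U: "graphon unit_interval U" and holder: "holder_graphon_on \<beta> {0..1} U"
    and \<beta>: "0 < \<beta>" "\<alpha> / real CARD('d) < \<beta>"
  shows "\<not> graphon_equivalent (leb unit_cube) W unit_interval U"
proof
  assume "graphon_equivalent (leb unit_cube) W unit_interval U"
  then interpret E: equivalent_graphons "leb (unit_cube :: (real ^ 'd) set)" W unit_interval U
    using U graphon_lacunary
    by (simp add: equivalent_graphons_def equivalent_graphons_axioms_def graphon_imp_graphon_space)
  obtain C where C: "\<And>p p'. p \<in> {0..1} \<times> {0..1} \<Longrightarrow> p' \<in> {0..1} \<times> {0..1} \<Longrightarrow>
      \<bar>(case p of (x, y) \<Rightarrow> U x y) - (case p' of (x, y) \<Rightarrow> U x y)\<bar> \<le> C * norm (p - p') powr \<beta>"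
    using holder unfolding holder_graphon_on_def holder_on_def by blast
  have "\<alpha> / \<beta> < real CARD('d)" using \<beta> by (simp add: field_simps)
  from exponential_gap[OF \<alpha>(1) \<beta>(1) a this, of C] obtain K n :: nat and \<delta> where
    \<delta>: "0 < \<delta>" "\<delta> \<le> 1 / 2" and n: "real n * (C\<^sup>2 * \<delta> powr (2 * \<beta>)) \<le> 1 / 2"
    and gap: "(6 * (1 / 4 / 2 ^ K)) ^ CARD('d) + exp (- (real n * (eigenval K)\<^sup>2)) < \<delta> / 2"
    unfolding eigenval_def by blast
  let ?r = "(eigenval K)\<^sup>2"
  have r: "0 < ?r" "?r \<le> 1" using eigenval_pos[of K] eigenval_le_1 by auto
  obtain N where "(1 - ?r) ^ N < 1 / 2"
    using real_arch_pow_inv[of "1 / 2" "1 - ?r"] r by auto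
  moreover have "(1 - ?r) ^ (2 * N) \<le> (1 - ?r) ^ N" using r by (intro power_decreasing) auto
  ultimately have N: "(1 - ?r) ^ (2 * N) \<le> 1 / 2" by simp
  have "\<delta> / 2 \<le> (\<integral>x. (\<integral>y. (1 - trunc_dist unit_interval U (2 * N) x y) ^ n \<partial>unit_interval) \<partial>unit_interval)"
    by (rule holder_moment_lower_bound[OF U C \<beta>(1) \<delta> n])
  also have "\<dots> = (\<integral>x. (\<integral>y. (1 - trunc_dist (leb unit_cube) W (2 * N) x y) ^ n \<partial>leb unit_cube) \<partial>leb unit_cube)"
    by (rule E.trunc_dist_moment_eq[symmetric])
  also have "\<dots> \<le> (6 * (1 / 4 / 2 ^ K)) ^ CARD('d) + (1 - ?r) ^ n"
    by (rule lacunary_moment_upper_bound[OF N])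
  also have "(1 - ?r) ^ n \<le> exp (- (real n * ?r))"
  proof -
    have "(1 - ?r) ^ n \<le> exp (- ?r) ^ n"
      using r exp_ge_add_one_self[of "- ?r"] by (intro power_mono) auto
    then show ?thesis using exp_of_nat_mult[of n "- ?r"] by simp
  qed
  finally show False using gap by simp
qed

end

theorem mainTheorem3:
  fixes \<alpha> a :: real
    and W :: "real ^ 'd \<Rightarrow> real ^ 'd \<Rightarrow> real"
  assumes "CARD('d) \<ge> 2"
    and "0 < \<alpha>" and "\<alpha> < 1"
    and "a > 0"
    and "\<And>x y. x \<in> unit_cube \<Longrightarrow> y \<in> unit_cube \<Longrightarrow>
           W x y = 1 / 2 + a * (\<Sum>i\<in>UNIV. lacunary_cos \<alpha> (x $ i - y $ i))"
    and "\<And>x y. x \<in> unit_cube \<Longrightarrow> y \<in> unit_cube \<Longrightarrow> 0 \<le> W x y \<and> W x y \<le> 1"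
  shows "graphon (leb unit_cube) W \<and>
         holder_graphon_on \<alpha> unit_cube W \<and>
         (\<forall>\<beta> U. 0 < \<beta> \<and> \<beta> \<le> 1 \<and> \<beta> > \<alpha> / real CARD('d) \<and>
            graphon (leb {0..1::real}) U \<and> holder_graphon_on \<beta> {0..1::real} U \<longrightarrow>
            \<not> graphon_equivalent (leb unit_cube) W (leb {0..1::real}) U)"
  using graphon_lacunary[OF assms(2-6)] holder_lacunary[OF assms(2-6)]
    not_equivalent_holder[OF assms(2-6)] by blast

end
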